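(* Let $m=2k$ with $k\in\mathbb{N}$, and let $u(t,x)$ be the solution of the even-order heat equation $$\frac{\partial u(t,x)}{\partial t}=(-1)^{\frac m2+1}\frac{\partial^m u(t,x)}{\partial x^m},\qquad t>0,\ x\in\mathbb{R},$$ with random initial condition $u(0,x)=\eta(x)=M(x)+\xi(x)$, given by $$u(t,x)=\int_{\mathbb{R}} M(x-y)\,u_m(t,y)\,dy+\int_{\mathbb{R}} e^{i\lambda x-\lambda^m t}\sqrt{f(\lambda)}\,W(d\lambda),$$ where $u_m(t,y)=\frac{1}{2\pi}\int_{\mathbb{R}}e^{-i\alpha y-\alpha^m t}\,d\alpha$. Suppose the covariance function of $\xi$ satisfies Assumption B with $A_0\neq0$. For $\varepsilon>0$ define $$U_\varepsilon(t,x)=\varepsilon^{-\kappa_0/4}\Big(u\big(t\varepsilon^{-m/2},x\varepsilon^{-1/2}\big)-\mathbb{E}\,u\big(t\varepsilon^{-m/2},x\varepsilon^{-1/2}\big)\Big).$$ Then, as $\varepsilon\to0$, the finite-dimensional distributions of $U_\varepsilon$ converge weakly to those of the zero-mean Gaussian random field $$U_0(t,x)=\sqrt{A_0c_2(\kappa_0)}\int_{\mathbb{R}}\frac{e^{i\lambda x-\lambda^m t}}{|\lambda|^{\frac{1-\kappa_0}{2}}}\,W(d\lambda),$$ whose covariance function is $$\operatorname{Cov}(U_0(t,x),U_0(t',x'))=A_0c_2(\kappa_0)\int_{\mathbb{R}}|\lambda|^{\kappa_0-1}\cos(\lambda(x-x'))e^{-(t+t')\lambda^m}d\lambda=\fr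ac{2\sqrt{\pi}A_0c_2(\kappa_0)}{m(t+t')^{\kappa_0/m}}\;{}_1\Psi_1\!\left[\begin{array}{c}(\kappa_0/m,\,2/m)\\(1/2,\,1)\end{array};-\frac{(x-x')^2}{4(t+t')^{2/m}}\right].$$
   Context: $(\Omega,\mathscr F,\mathbb P)$ is a complete probability space. $M:\mathbb{R}\to\mathbb{R}$ is a deterministic function for which the convolution integrals above are well defined. $\xi(x)$, $x\in\mathbb{R}$, is a real-valued, measurable, mean-square continuous, stationary Gaussian process with $\mathbb{E}\xi(x)=0$, $\mathbb{E}\xi^2(x)=1$, absolutely continuous spectral measure with spectral density $f$, and spectral representation $\xi(x)=\int_{\mathbb{R}}e^{i\lambda x}\sqrt{f(\lambda)}\,W(d\lambda)$, where $W$ is a complex Gaussian white-noise random measure on $\mathbb{R}$ chosen symmetric about the origin (so that all fields are real-valued), integrals being understood in $L_2(\Omega)$. Assumption B: the covariance function of $\xi$ is $r(x)=\sum_{j=0}^n A_j\frac{\cos(w_jx)}{(1+x^2)^{\kappa_j/2}}$, $x\in\mathbb{R}$, where $A_j\ge0$, $\sum_{j=0}^nA_j=1$, $w_0=0$, $w_j\neq0$ for $j\ge1$, and $\kappa_j\in(0,1)$ for $j=0,\dots,n$. Its spectral density is $$f(\lambda)=\sum_{j=0}^n\frac{c_1(\kappa_j)}{2}A_j\left(\frac{K_{\frac{\kappa_j-1}{2}}(|\lambda+w_j|)}{|\lambda+w_j|^{\frac{1-\kappa_j}{2}}}+\frac{K_{\frac{\kappa_j-1}{2}}(|\lambda-w_j|)}{|\lambda-w_j|^{\frac{1-\kappa_j}{2}}}\right),$$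 with $c_1(\kappa)=2^{\frac{1-\kappa}{2}}/(\sqrt{\pi}\,\Gamma(\kappa/2))$ and $K_\nu$ the modified Bessel function of the second kind. Also $c_2(\kappa)=\big(2\Gamma(\kappa)\cos(\kappa\pi/2)\big)^{-1}$. The Fox–Wright function is ${}_p\Psi_q\!\left[\begin{array}{c}(\alpha_1,A_1),\dots,(\alpha_p,A_p)\\(\beta_1,B_1),\dots,(\beta_q,B_q)\end{array};z\right]=\sum_{n=0}^\infty\frac{\prod_{j=1}^p\Gamma(\alpha_j+A_jn)}{\prod_{k=1}^q\Gamma(\beta_k+B_kn)}\frac{z^n}{n!}$ (with $A_j,B_k>0$, $1+\sum B_k-\sum A_j>0$). *)

theory Defs
  imports "HOL-Probability.Probability"
begin

definition L2c :: "(real \<Rightarrow> complex) \<Rightarrow> bool" where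
  "L2c g \<longleftrightarrow> g \<in> borel_measurable lborel \<and> integrable lborel (\<lambda>l. (cmod (g l))\<^sup>2)"

text \<open>Hermitian symmetry: g(-l) = conj(g l); such integrands give real-valued integrals.\<close>
definition hermitian :: "(real \<Rightarrow> complex) \<Rightarrow> bool" where
  "hermitian g \<longleftrightarrow> (\<forall>l. g (- l) = cnj (g l))"

text \<open>I is the stochastic integral g \<mapsto> \<integral> g(l) W(dl) with respect to a complex Gaussian
  white-noise random measure W on the real line that is symmetric about the origin
  (W(-A) = conj W(A)), with control measure Lebesgue measure.
  Characterised as: complex-linear (in L2(Omega)), measurable, compatible with the symmetry,
  and for Hermitian integrands real-valued, centred normal with variance \<integral>|g|^2.\<close>
definition complex_white_noise_integral ::
    "'a measure \<Rightarrow> ((real \<Rightarrow> complex) \<Rightarrow> 'a \<Rightarrow> complex) \<Rightarrow> bool" where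
  "complex_white_noise_integral P I \<longleftrightarrow>
     prob_space P \<and>
     (\<forall>g. L2c g \<longrightarrow> I g \<in> borel_measurable P) \<and>
     (\<forall>g h (a::complex) (b::complex). L2c g \<longrightarrow> L2c h \<longrightarrow>
         (AE \<omega> in P. I (\<lambda>l. a * g l + b * h l) \<omega> = a * I g \<omega> + b * I h \<omega>)) \<and>
     (\<forall>g. L2c g \<longrightarrow> (AE \<omega> in P. I (\<lambda>l. cnj (g (- l))) \<omega> = cnj (I g \<omega>))) \<and>
     (\<forall>g. L2c g \<longrightarrow> hermitian g \<longrightarrow>
        (let v = integral\<^sup>L lborel (\<lambda>l. (cmod (g l))\<^sup>2) in
          (AE \<omega> in P. Im (I g \<omega>) = 0) \<and>
          (if v = 0 then (AE \<omega> in P. I g \<omega> = 0)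
           else distributed P lborel (\<lambda>\<omega>. Re (I g \<omega>))
                  (\<lambda>x. ennreal (normal_density 0 (sqrt v) x)))))"

definition cov_B :: "nat \<Rightarrow> (nat \<Rightarrow> real) \<Rightarrow> (nat \<Rightarrow> real) \<Rightarrow> (nat \<Rightarrow> real) \<Rightarrow> real \<Rightarrow> real" where
  "cov_B n A w \<kappa> x = (\<Sum>j=0..n. A j * cos (w j * x) / (1 + x\<^sup>2) powr (\<kappa> j / 2))"

definition c2 :: "real \<Rightarrow> real" where
  "c2 \<kappa> = 1 / (2 * Gamma \<kappa> * cos (\<kappa> * pi / 2))"

definition fox_wright_1_1 :: "real \<Rightarrow> real \<Rightarrow> real \<Rightarrow> real \<Rightarrow> real \<Rightarrow> real" where
  "fox_wright_1_1 a A b B z = (\<Sum>k. Gamma (a + A * real k) / Gamma (b + B * real k) * z ^ k / fact k)"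

definition um :: "nat \<Rightarrow> real \<Rightarrow> real \<Rightarrow> complex" where
  "um m t y = complex_of_real (1 / (2 * pi)) *
     integral\<^sup>L lborel (\<lambda>a. exp (- \<i> * complex_of_real (a * y) - complex_of_real (a ^ m * t)))"

text \<open>Solution u(t,x) of the heat equation with initial condition M + xi,
  xi(x) = \<integral> e^{i l x} sqrt(f l) W(dl).\<close>
definition heat_sol :: "(real \<Rightarrow> real) \<Rightarrow> ((real \<Rightarrow> complex) \<Rightarrow> 'a \<Rightarrow> complex) \<Rightarrow>
     (real \<Rightarrow> real) \<Rightarrow> nat \<Rightarrow> real \<Rightarrow> real \<Rightarrow> 'a \<Rightarrow> complex" where
  "heat_sol M I f m t x \<omega> =
     integral\<^sup>L lborel (\<lambda>y. complex_of_real (M (x - y)) * um m t y)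
     + I (\<lambda>l. exp (\<i> * complex_of_real (l * x) - complex_of_real (l ^ m * t))
              * complex_of_real (sqrt (f l))) \<omega>"

definition U_eps :: "'a measure \<Rightarrow> (real \<Rightarrow> real) \<Rightarrow> ((real \<Rightarrow> complex) \<Rightarrow> 'a \<Rightarrow> complex) \<Rightarrow>
     (real \<Rightarrow> real) \<Rightarrow> nat \<Rightarrow> real \<Rightarrow> real \<Rightarrow> real \<Rightarrow> real \<Rightarrow> 'a \<Rightarrow> complex" where
  "U_eps P M I f m \<kappa>0 \<epsilon> t x \<omega> =
     complex_of_real (\<epsilon> powr (- \<kappa>0 / 4)) *
       (heat_sol M I f m (t * \<epsilon> powr (- real m / 2)) (x * \<epsilon> powr (- 1 / 2)) \<omega>
        - integral\<^sup>L P (\<lambda>\<omega>'. heat_sol M I f m (t * \<epsilon> powr (- real m / 2)) (x * \<epsilon> powr (- 1 / 2)) \<omega>'))"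

definition U_zero :: "((real \<Rightarrow> complex) \<Rightarrow> 'a \<Rightarrow> complex) \<Rightarrow> nat \<Rightarrow> real \<Rightarrow> real \<Rightarrow>
     real \<Rightarrow> real \<Rightarrow> 'a \<Rightarrow> complex" where
  "U_zero I m A0 \<kappa>0 t x \<omega> =
     complex_of_real (sqrt (A0 * c2 \<kappa>0)) *
       I (\<lambda>l. exp (\<i> * complex_of_real (l * x) - complex_of_real (l ^ m * t))
              / complex_of_real (\<bar>l\<bar> powr ((1 - \<kappa>0) / 2))) \<omega>"

end

theory Submission
  imports Defs
begin

text \<open>
  Every linear combination of values of \<open>U\<^sub>\<epsilon>\<close> is a centred normal variable, so its law is determined
  by its variance \<open>\<delta>\<^bsup>-\<kappa>\<^sub>0\<^esup> \<integral> \<Phi>(l/\<delta>) f(l) dl\<close> with \<open>\<delta> = \<epsilon>\<^bsup>1/2\<^esup>\<close>, where \<open>\<Phi>\<close> is the squared modulus of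
  a combination of the functions \<open>exp (i l x - l\<^sup>m t)\<close>. Writing \<open>(1 + x\<^sup>2)\<^bsup>-\<kappa>/2\<^esup>\<close> as a Gamma mixture of
  Gaussian characteristic functions and using Levy's uniqueness theorem identifies \<open>f\<close> almost
  everywhere as a sum of shifted densities, each equal to \<open>|l|\<^bsup>\<kappa>-1\<^esup>\<close> times a factor that is bounded by
  \<open>c\<^sub>2(\<kappa>)\<close> and tends to it at the origin. Dominated convergence gives the limit of the unshifted
  term; the shifted ones contribute \<open>O(\<delta>\<^bsup>1-\<kappa>\<^sub>0\<^esup>)\<close>. Convergence of characteristic functions together
  with bounded second moments yields weak convergence in several dimensions, since a bounded
  continuous function is approximated on large boxes by trigonometric polynomials. The
  Fox--Wright form of the covariance comes from integrating the cosine series term by term.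
\<close>

section \<open>Weak convergence from characteristic functions\<close>

text \<open>The exponent of the normalisation comes from homogeneity: near the origin the spectral
  density behaves like A_0 c_2 |l|^(kappa_0 - 1), so its integral against a weight living on |l| of
  order delta has size delta^kappa_0. The singularities at w_j and -w_j stay at a fixed distance
  from that window, so the exponents kappa_j with j > 0 do not enter the rate, even when they are
  smaller than kappa_0. The constant c_2 arises as a Gamma integral at l = 0, brought to its cosine
  form by the duplication and reflection formulas; the mixture gives sign, bound and limit of the
  regular factor at once, without asymptotics of Bessel functions. The obstacle on the probabilistic
  side is that \<open>f\<close> is known only through its Fourier transform, hence only up to a null
  set, while \<open>I\<close> acts on functions and its law is prescribed only for Hermitian ones.
  So \<open>f\<close> is traded for an explicit even version, and it has to be shown that
  \<open>I\<close> ignores null sets. The function \<open>M\<close> contributes a constant, which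
  centring removes.\<close>

inductive trig_poly :: "('a::real_inner \<Rightarrow> complex) \<Rightarrow> bool" where
  trig_poly_cis: "trig_poly (\<lambda>x. c * cis (a \<bullet> x))"
| trig_poly_add: "trig_poly f \<Longrightarrow> trig_poly g \<Longrightarrow> trig_poly (\<lambda>x. f x + g x)"

lemma trig_poly_const: "trig_poly (\<lambda>x. c)"
  using trig_poly_cis[of c 0] by simp

lemma trig_poly_mult_cis: "trig_poly f \<Longrightarrow> trig_poly (\<lambda>x. f x * (c * cis (a \<bullet> x)))"
proof (induction rule: trig_poly.induct)
  case (trig_poly_cis d b)
  have "(\<lambda>x. d * cis (b \<bullet> x) * (c * cis (a \<bullet> x))) = (\<lambda>x. (d * c) * cis ((b + a) \<bullet> x))"
    by (auto simp: inner_add_left cis_mult[symmetric])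
  then show ?case
    using trig_poly.trig_poly_cis by metis
next
  case (trig_poly_add f g)
  then show ?case
    using trig_poly.trig_poly_add by (simp add: distrib_right)
qed

text \<open>The class is generated by sums alone, so that statements about expectations follow by
  linearity. Closure under products comes from adding frequencies and is needed only to reach
  polynomials in sines.\<close>

lemma trig_poly_mult: "trig_poly g \<Longrightarrow> trig_poly f \<Longrightarrow> trig_poly (\<lambda>x. f x * g x)"
proof (induction rule: trig_poly.induct)
  case (trig_poly_cis c a)
  then show ?case by (rule trig_poly_mult_cis)
next
  case (trig_poly_add g h)
  then show ?case
    using trig_poly.trig_poly_add by (simp add: distrib_left)
qed

lemma trig_poly_sum:
  assumes "finite S" "\<And>j. j \<in> S \<Longrightarrow> trig_poly (f j)"
  shows "trig_poly (\<lambda>x. \<Sum>j\<in>S. f j x)"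
  using assms
  by (induction S rule: finite_induct) (auto intro: trig_poly_const trig_poly_add)

lemma trig_poly_sin: "trig_poly (\<lambda>x. complex_of_real (sin (a \<bullet> x)))"
proof -
  have "complex_of_real (sin (a \<bullet> x)) = 1 / (2 * \<i>) * cis (a \<bullet> x) + (- 1 / (2 * \<i>)) * cis ((- a) \<bullet> x)" for x
    by (simp add: complex_eq_iff)
  moreover have "trig_poly (\<lambda>x. 1 / (2 * \<i>) * cis (a \<bullet> x) + (- 1 / (2 * \<i>)) * cis ((- a) \<bullet> x))"
    by (intro trig_poly_add trig_poly_cis)
  ultimately show ?thesis by simp
qed

lemma trig_poly_polynomial_sin:
  fixes p :: "real ^ 'n \<Rightarrow> real"
  assumes "real_polynomial_function p"
  shows "trig_poly (\<lambda>x::real^'n. complex_of_real (p (\<chi> j. sin (c * x $ j))))"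
  using assms
proof (induction rule: real_polynomial_function.induct)
  case (linear f)
  then interpret bounded_linear f .
  \<comment> \<open>A linear functional of the vector of sines is expanded in coordinates, since
    only sines of a single inner product are known to be trigonometric; the vector
    \<open>axis j c\<close> carries the scale.\<close>
  have *: "f (\<chi> j. s j) = (\<Sum>j\<in>UNIV. s j * f (axis j 1))" for s :: "'n \<Rightarrow> real"
  proof -
    have "f (\<chi> j. s j) = f (\<Sum>j\<in>UNIV. s j *\<^sub>R axis j 1)"
      by (rule arg_cong[where f = f]) (simp add: vec_eq_iff axis_def if_distrib[where f="\<lambda>x. _ * x"] cong: if_cong)
    then show ?thesis by (simp add: sum scaleR)
  qed
  have "trig_poly (\<lambda>x::real^'n. \<Sum>j\<in>UNIV. complex_of_real (sin ((axis j c) \<bullet> x)) * complex_of_real (f (axis j 1)))"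
    by (intro trig_poly_sum trig_poly_mult trig_poly_sin trig_poly_const) auto
  then show ?case
    by (simp add: * inner_axis')
next
  case (const c)
  then show ?case by (simp add: trig_poly_const)
next
  case (add f g)
  then show ?case by (simp add: trig_poly_add)
next
  case (mult f g)
  then show ?case by (simp add: trig_poly_mult)
qed

lemma trig_poly_bounded: "trig_poly f \<Longrightarrow> \<exists>B. \<forall>x. cmod (f x) \<le> B"
proof (induction rule: trig_poly.induct)
  case (trig_poly_cis c a)
  then show ?case by (intro exI[of _ "cmod c"]) (simp add: norm_mult)
next
  case (trig_poly_add f g)
  then show ?case by (metis add_mono norm_triangle_le)
qed

lemma trig_poly_measurable: "trig_poly f \<Longrightarrow> (f :: 'a::euclidean_space \<Rightarrow> complex) \<in> borel_measurable borel"
proof (induction rule: trig_poly.induct)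
  case (trig_poly_cis c a)
  have "continuous_on UNIV (\<lambda>x. c * cis (a \<bullet> x))"
    unfolding cis_conv_exp by (intro continuous_intros)
  then show ?case by (rule borel_measurable_continuous_onI)
qed simp

context prob_space
begin

lemma integrable_trig_poly:
  fixes X :: "'a \<Rightarrow> 'c::euclidean_space"
  assumes "trig_poly f" "X \<in> borel_measurable M"
  shows "integrable M (\<lambda>\<omega>. f (X \<omega>))"
proof -
  obtain B where "\<And>x. cmod (f x) \<le> B"
    using trig_poly_bounded[OF assms(1)] by blast
  then show ?thesis
    using trig_poly_measurable[OF assms(1)] assms(2)
    by (intro integrable_const_bound[of _ B]) auto
qed

lemma tendsto_expectation_trig_poly:
  fixes X :: "'b \<Rightarrow> 'a \<Rightarrow> 'c::euclidean_space"
  assumes "trig_poly f"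
    and X: "\<forall>\<^sub>F e in F. X e \<in> borel_measurable M" and Y: "Y \<in> borel_measurable M"
    and char: "\<And>a. ((\<lambda>e. \<integral>\<omega>. cis (a \<bullet> X e \<omega>) \<partial>M) \<longlongrightarrow> (\<integral>\<omega>. cis (a \<bullet> Y \<omega>) \<partial>M)) F"
  shows "((\<lambda>e. \<integral>\<omega>. f (X e \<omega>) \<partial>M) \<longlongrightarrow> (\<integral>\<omega>. f (Y \<omega>) \<partial>M)) F"
  using assms(1)
proof (induction rule: trig_poly.induct)
  case (trig_poly_cis c a)
  show ?case by (simp add: tendsto_mult_left char)
next
  case (trig_poly_add f g)
  have "((\<lambda>e. (\<integral>\<omega>. f (X e \<omega>) \<partial>M) + (\<integral>\<omega>. g (X e \<omega>) \<partial>M)) \<longlongrightarrow> (\<integral>\<omega>. f (Y \<omega>) + g (Y \<omega>) \<partial>M)) F"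
    using trig_poly_add Y by (simp add: integrable_trig_poly tendsto_add)
  \<comment> \<open>Additivity of the expectation for \<open>X e\<close> holds only eventually,
    because \<open>X e\<close> is measurable only eventually.\<close>
  then show ?case
    by (rule Lim_transform_eventually)
      (use X in \<open>eventually_elim, use trig_poly_add in \<open>simp add: integrable_trig_poly\<close>\<close>)
qed

end

text \<open>On the box of half-width \<open>R\<close> the coordinate is recovered as \<open>x = arcsin (sin (c x)) / c\<close>
  with \<open>c = \<pi> / (2 R)\<close>, so \<open>g\<close> coincides there with a continuous function on the compact cube
  composed with the sines, which Stone--Weierstrass approximates; outside the box the error is
  absorbed by the second moment.\<close>
lemma trig_poly_approximation:
  fixes g :: "real ^ 'n \<Rightarrow> real"
  assumes g: "continuous_on UNIV g" and B: "\<And>x. \<bar>g x\<bar> \<le> B" and R: "R > 0" and d: "d > 0"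
  obtains p where "trig_poly (\<lambda>x. complex_of_real (p x))"
    and "\<And>x. \<bar>g x - p x\<bar> \<le> 2 * B * (norm x)\<^sup>2 / R\<^sup>2 + d"
proof -
  define c where "c = pi / (2 * R)"
  have c: "c > 0" using R by (simp add: c_def)
  define S :: "(real^'n) set" where "S = cbox (- 1) 1"
  define G where "G = (\<lambda>s::real^'n. g (\<chi> j. arcsin (s $ j) / c))"
  have S_iff: "s \<in> S \<longleftrightarrow> (\<forall>j. -1 \<le> s $ j \<and> s $ j \<le> 1)" for s
    by (simp add: S_def mem_box_cart)
  have "continuous_on S G"
    unfolding G_def
    by (rule continuous_on_compose2[OF g])
      (use c in \<open>auto intro!: continuous_intros continuous_on_vec_lambda continuous_on_component simp: S_iff\<close>)
  moreover have "compact S" by (simp add: S_def)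
  ultimately obtain q where q: "real_polynomial_function q" "\<And>s. s \<in> S \<Longrightarrow> \<bar>G s - q s\<bar> < d"
    using Stone_Weierstrass_real_polynomial_function[of S G d] d by metis
  define \<phi> where "\<phi> = (\<lambda>x::real^'n. (\<chi> j. sin (c * x $ j)) :: real^'n)"
  have \<phi>S: "\<phi> x \<in> S" for x by (simp add: S_iff \<phi>_def)
  have B0: "B \<ge> 0" using B[of 0] by linarith
  have main: "\<bar>g x - G (\<phi> x)\<bar> \<le> 2 * B * (norm x)\<^sup>2 / R\<^sup>2" for x
  proof (cases "norm x \<le> R")
    case True
    have "arcsin (sin (c * x $ j)) = c * x $ j" for j
    proof (rule arcsin_sin)
      have "\<bar>x $ j\<bar> \<le> R" using component_le_norm_cart[of x j] True by linarith
      then have "\<bar>c * x $ j\<bar> \<le> pi / 2"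
        using c R by (auto simp: abs_mult c_def field_simps)
      then show "- (pi / 2) \<le> c * x $ j" "c * x $ j \<le> pi / 2" by linarith+
    qed
    then have "G (\<phi> x) = g x"
      using c by (simp add: G_def \<phi>_def)
    then show ?thesis using B0 by simp
  next
    case False
    \<comment> \<open>\<open>G\<close> takes only values of \<open>g\<close>, so it inherits the
      bound \<open>B\<close>; outside the ball the factor
      \<open>(norm x)\<^sup>2 / R\<^sup>2\<close> is at least 1.\<close>
    have "\<bar>g x - G (\<phi> x)\<bar> \<le> 2 * B"
      using B[of x] B[of "\<chi> j. arcsin (\<phi> x $ j) / c"] by (auto simp: G_def)
    also have "\<dots> \<le> 2 * B * ((norm x)\<^sup>2 / R\<^sup>2)"
    proof -
      have "1 \<le> (norm x)\<^sup>2 / R\<^sup>2"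
        using False R by (simp add: power_mono)
      then show ?thesis using B0 mult_left_mono[of 1 "(norm x)\<^sup>2 / R\<^sup>2" "2 * B"] by simp
    qed
    finally show ?thesis by simp
  qed
  show ?thesis
  proof (rule that[of "\<lambda>x. q (\<phi> x)"])
    show "trig_poly (\<lambda>x. complex_of_real (q (\<phi> x)))"
      unfolding \<phi>_def by (rule trig_poly_polynomial_sin[OF q(1)])
    show "\<bar>g x - q (\<phi> x)\<bar> \<le> 2 * B * (norm x)\<^sup>2 / R\<^sup>2 + d" for x
      using main[of x] q(2)[OF \<phi>S[of x]] by linarith
  qed
qed

text \<open>The continuity theorem for characteristic functions in several dimensions, with
  tightness supplied by the common bound \<open>V\<close>. This bound makes the error of one fixed
  trigonometric approximation uniform along the filter, so only that single approximant has to pass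
  to the limit.\<close>

lemma (in prob_space) tendsto_expectation_of_char:
  fixes X :: "'b \<Rightarrow> 'a \<Rightarrow> real ^ 'n" and g :: "real ^ 'n \<Rightarrow> real"
  assumes X: "\<forall>\<^sub>F e in F. X e \<in> borel_measurable M \<and> integrable M (\<lambda>\<omega>. (norm (X e \<omega>))\<^sup>2)
                \<and> (\<integral>\<omega>. (norm (X e \<omega>))\<^sup>2 \<partial>M) \<le> V"
    and Y: "Y \<in> borel_measurable M" "integrable M (\<lambda>\<omega>. (norm (Y \<omega>))\<^sup>2)"
    and YV: "(\<integral>\<omega>. (norm (Y \<omega>))\<^sup>2 \<partial>M) \<le> V"
    and char: "\<And>a. ((\<lambda>e. \<integral>\<omega>. cis (a \<bullet> X e \<omega>) \<partial>M) \<longlongrightarrow> (\<integral>\<omega>. cis (a \<bullet> Y \<omega>) \<partial>M)) F"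
    and g: "continuous_on UNIV g" "bounded (range g)"
  shows "((\<lambda>e. \<integral>\<omega>. g (X e \<omega>) \<partial>M) \<longlongrightarrow> (\<integral>\<omega>. g (Y \<omega>) \<partial>M)) F"
proof (rule tendstoI)
  fix e :: real assume e: "e > 0"
  obtain B where B: "\<And>x. \<bar>g x\<bar> \<le> B"
    using g(2) by (auto simp: bounded_iff)
  have B0: "B \<ge> 0" using B[of 0] by linarith
  have "0 \<le> (\<integral>\<omega>. (norm (Y \<omega>))\<^sup>2 \<partial>M)" by simp
  with YV have V0: "V \<ge> 0" by linarith
  \<comment> \<open>The total error is \<open>2 * d\<close> for \<open>X\<close>,
    \<open>2 * d\<close> for \<open>Y\<close> and \<open>d\<close> for the approximant, that is 5/8
    of \<open>e\<close>. The summand 1 in \<open>R\<close> keeps it positive when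
    \<open>B * V = 0\<close>; the rest makes \<open>2 * B * V / R\<^sup>2\<close> at most
    \<open>d\<close>.\<close>
  define d where "d = e / 8"
  define R where "R = sqrt (2 * B * V / d + 1)"
  have d: "d > 0" using e by (simp add: d_def)
  have "2 * B * V / d + 1 > 0"
    using B0 V0 d by (intro add_nonneg_pos) auto
  then have R: "R > 0" "R\<^sup>2 = 2 * B * V / d + 1" by (simp_all add: R_def)
  have RV: "2 * B * V / R\<^sup>2 \<le> d"
    using R d B0 V0 by (simp add: field_simps)
  obtain p where p: "trig_poly (\<lambda>x. complex_of_real (p x))"
    "\<And>x. \<bar>g x - p x\<bar> \<le> 2 * B * (norm x)\<^sup>2 / R\<^sup>2 + d"
    using trig_poly_approximation[OF g(1) B R(1) d] by metis
  have gm: "g \<in> borel_measurable borel"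
    using g(1) by (rule borel_measurable_continuous_onI)
  have est: "\<bar>(\<integral>\<omega>. g (Z \<omega>) \<partial>M) - (\<integral>\<omega>. p (Z \<omega>) \<partial>M)\<bar> \<le> 2 * d"
    if Z: "Z \<in> borel_measurable M" "integrable M (\<lambda>\<omega>. (norm (Z \<omega>))\<^sup>2)" "(\<integral>\<omega>. (norm (Z \<omega>))\<^sup>2 \<partial>M) \<le> V"
    for Z
  proof -
    have i1: "integrable M (\<lambda>\<omega>. g (Z \<omega>))"
      using B gm Z(1) by (intro integrable_const_bound[of _ B]) auto
    have i2: "integrable M (\<lambda>\<omega>. p (Z \<omega>))"
      using integrable_Re[OF integrable_trig_poly[OF p(1) Z(1)]] by simp
    have "\<bar>(\<integral>\<omega>. g (Z \<omega>) \<partial>M) - (\<integral>\<omega>. p (Z \<omega>) \<partial>M)\<bar> = \<bar>\<integral>\<omega>. g (Z \<omega>) - p (Z \<omega>) \<partial>M\<bar>"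
      using i1 i2 by simp
    also have "\<dots> \<le> (\<integral>\<omega>. \<bar>g (Z \<omega>) - p (Z \<omega>)\<bar> \<partial>M)"
      by (rule integral_abs_bound)
    also have "\<dots> \<le> (\<integral>\<omega>. 2 * B * (norm (Z \<omega>))\<^sup>2 / R\<^sup>2 + d \<partial>M)"
      using i1 i2 Z(2) p(2) by (intro integral_mono) auto
    also have "\<dots> = 2 * B * (\<integral>\<omega>. (norm (Z \<omega>))\<^sup>2 \<partial>M) / R\<^sup>2 + d"
      using Z(2) by (simp add: prob_space)
    also have "\<dots> \<le> 2 * B * V / R\<^sup>2 + d"
      using Z(3) B0 by (intro add_right_mono divide_right_mono mult_left_mono) auto
    finally show ?thesis using RV by linarith
  qed
  have "((\<lambda>e. \<integral>\<omega>. complex_of_real (p (X e \<omega>)) \<partial>M) \<longlongrightarrow> (\<integral>\<omega>. complex_of_real (p (Y \<omega>)) \<partial>M)) F"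
    by (rule tendsto_expectation_trig_poly[OF p(1) _ Y(1) char]) (use X in \<open>auto elim: eventually_mono\<close>)
  then have "((\<lambda>e. \<integral>\<omega>. p (X e \<omega>) \<partial>M) \<longlongrightarrow> (\<integral>\<omega>. p (Y \<omega>) \<partial>M)) F"
    by (simp add: tendsto_of_real_iff)
  then have "\<forall>\<^sub>F e in F. dist (\<integral>\<omega>. p (X e \<omega>) \<partial>M) (\<integral>\<omega>. p (Y \<omega>) \<partial>M) < d"
    using d by (rule tendstoD)
  with X show "\<forall>\<^sub>F i in F. dist (\<integral>\<omega>. g (X i \<omega>) \<partial>M) (\<integral>\<omega>. g (Y \<omega>) \<partial>M) < e"
  proof eventually_elim
    case (elim i)
    then have "\<bar>(\<integral>\<omega>. g (X i \<omega>) \<partial>M) - (\<integral>\<omega>. p (X i \<omega>) \<partial>M)\<bar> \<le> 2 * d"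
      "\<bar>(\<integral>\<omega>. g (Y \<omega>) \<partial>M) - (\<integral>\<omega>. p (Y \<omega>) \<partial>M)\<bar> \<le> 2 * d"
      using est[of "X i"] est[of Y] Y YV by blast+
    then show ?case
      using elim e unfolding dist_real_def d_def by linarith
  qed
qed

section \<open>The white noise integral\<close>

lemma borel_measurable_cis [measurable]: "cis \<in> borel_measurable borel"
  unfolding cis_conv_exp by (intro borel_measurable_continuous_onI continuous_intros)

text \<open>Scaling by \<open>\<sigma>\<close> reduces this to the standard normal law. It serves
  both for the law of \<open>I g\<close> and for the normal densities in the Gamma mixture.\<close>

lemma integral_normal_density_cis:
  assumes "\<sigma> > 0"
  shows "(\<integral>l. normal_density 0 \<sigma> l *\<^sub>R cis (x * l) \<partial>lborel) = complex_of_real (exp (- (\<sigma> * x)\<^sup>2 / 2))"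
proof -
  have nd: "normal_density 0 \<sigma> (\<sigma> * y) = std_normal_density y / \<sigma>" for y
    using assms by (simp add: normal_density_def power_mult_distrib real_sqrt_mult)
  have "(\<integral>l. normal_density 0 \<sigma> l *\<^sub>R cis (x * l) \<partial>lborel)
      = \<bar>\<sigma>\<bar> *\<^sub>R (\<integral>y. normal_density 0 \<sigma> (0 + \<sigma> * y) *\<^sub>R cis (x * (0 + \<sigma> * y)) \<partial>lborel)"
    using assms by (intro lborel_integral_real_affine) auto
  also have "\<dots> = (\<integral>y. std_normal_density y *\<^sub>R cis ((\<sigma> * x) * y) \<partial>lborel)"
    using assms unfolding integral_scaleR_right[symmetric] by (intro Bochner_Integration.integral_cong) (simp_all add: nd mult.assoc mult.left_commute)
  also have "\<dots> = char std_normal_distribution (\<sigma> * x)"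
    unfolding char_def by (subst integral_density) (auto simp: cis_conv_exp)
  finally show ?thesis by (simp add: char_std_normal_distribution)
qed

section \<open>Square-integrable and Hermitian integrands\<close>

lemma L2c_measurable: "L2c g \<Longrightarrow> g \<in> borel_measurable borel"
  by (simp add: L2c_def)

lemma L2c_add: "L2c g \<Longrightarrow> L2c h \<Longrightarrow> L2c (\<lambda>l. a * g l + b * h l)"
proof -
  assume g: "L2c g" and h: "L2c h"
  have [measurable]: "g \<in> borel_measurable borel" "h \<in> borel_measurable borel"
    using g h by (simp_all add: L2c_def)
  have "(cmod (a * x + b * y))\<^sup>2 \<le> 2 * (cmod a)\<^sup>2 * (cmod x)\<^sup>2 + 2 * (cmod b)\<^sup>2 * (cmod y)\<^sup>2" for x y
  proof -
    have "cmod (a * x + b * y) \<le> cmod a * cmod x + cmod b * cmod y"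
      by (metis norm_mult norm_triangle_ineq)
    then have "(cmod (a * x + b * y))\<^sup>2 \<le> (cmod a * cmod x + cmod b * cmod y)\<^sup>2"
      by (rule power_mono) simp
    also have "\<dots> \<le> 2 * (cmod a * cmod x)\<^sup>2 + 2 * (cmod b * cmod y)\<^sup>2"
      using zero_le_power2[of "cmod a * cmod x - cmod b * cmod y"]
      by (simp add: power2_sum power2_diff)
    finally show ?thesis by (simp add: power_mult_distrib)
  qed
  then have le: "norm ((cmod (a * g l + b * h l))\<^sup>2) \<le> norm (2 * (cmod a)\<^sup>2 * (cmod (g l))\<^sup>2 + 2 * (cmod b)\<^sup>2 * (cmod (h l))\<^sup>2)" for l
    by (simp add: abs_of_nonneg)
  have i: "integrable lborel (\<lambda>l. 2 * (cmod a)\<^sup>2 * (cmod (g l))\<^sup>2 + 2 * (cmod b)\<^sup>2 * (cmod (h l))\<^sup>2)"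
    using g h by (simp add: L2c_def)
  have "integrable lborel (\<lambda>l. (cmod (a * g l + b * h l))\<^sup>2)"
  proof (rule Bochner_Integration.integrable_bound[OF i])
    show "(\<lambda>l. (cmod (a * g l + b * h l))\<^sup>2) \<in> borel_measurable lborel" by simp
    show "AE l in lborel. norm ((cmod (a * g l + b * h l))\<^sup>2)
        \<le> norm (2 * (cmod a)\<^sup>2 * (cmod (g l))\<^sup>2 + 2 * (cmod b)\<^sup>2 * (cmod (h l))\<^sup>2)"
      by (intro always_eventually allI le)
  qed
  then show ?thesis by (simp add: L2c_def)
qed

lemma L2c_zero: "L2c (\<lambda>l. 0)"
  by (simp add: L2c_def)

lemma L2c_sum: "finite S \<Longrightarrow> (\<And>j. j \<in> S \<Longrightarrow> L2c (g j)) \<Longrightarrow> L2c (\<lambda>l. \<Sum>j\<in>S. a j * g j l)"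
proof (induction S rule: finite_induct)
  case (insert j S)
  then have "L2c (\<lambda>l. a j * g j l + 1 * (\<Sum>j\<in>S. a j * g j l))"
    by (intro L2c_add) auto
  with insert show ?case by simp
qed (simp add: L2c_zero)

lemma L2c_reflect:
  assumes "L2c g"
  shows "L2c (\<lambda>l. cnj (g (- l)))"
proof -
  have [measurable]: "g \<in> borel_measurable borel" by (rule L2c_measurable[OF assms])
  have "cnj \<in> borel_measurable borel"
    by (intro borel_measurable_continuous_onI continuous_intros)
  then have "(\<lambda>l. cnj (g (- l))) \<in> borel_measurable borel"
    by (rule measurable_compose[rotated]) measurable
  then show ?thesis
    using assms lborel_integrable_real_affine[of "\<lambda>l. (cmod (g l))\<^sup>2" "-1" 0] by (simp add: L2c_def)
qed

lemma hermitian_sum: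
  fixes a :: "'b \<Rightarrow> real"
  shows "(\<And>j. j \<in> S \<Longrightarrow> hermitian (g j)) \<Longrightarrow> hermitian (\<lambda>l. \<Sum>j\<in>S. of_real (a j) * g j l)"
  by (simp add: hermitian_def)

section \<open>Moments and laws of the stochastic integral\<close>

locale white_noise =
  fixes P :: "'a measure" and I :: "(real \<Rightarrow> complex) \<Rightarrow> 'a \<Rightarrow> complex"
  assumes white_noise: "complex_white_noise_integral P I"
begin

sublocale prob_space P
  using white_noise by (simp add: complex_white_noise_integral_def)

lemma measurable_I: "L2c g \<Longrightarrow> I g \<in> borel_measurable P"
  using white_noise by (simp add: complex_white_noise_integral_def)

lemma I_add: "L2c g \<Longrightarrow> L2c h \<Longrightarrow> AE \<omega> in P. I (\<lambda>l. a * g l + b * h l) \<omega> = a * I g \<omega> + b * I h \<omega>"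
  using white_noise by (simp add: complex_white_noise_integral_def)

lemma Im_I: "L2c g \<Longrightarrow> hermitian g \<Longrightarrow> AE \<omega> in P. Im (I g \<omega>) = 0"
  using white_noise by (simp add: complex_white_noise_integral_def Let_def)

lemma I_null: "L2c g \<Longrightarrow> hermitian g \<Longrightarrow> (\<integral>l. (cmod (g l))\<^sup>2 \<partial>lborel) = 0 \<Longrightarrow> AE \<omega> in P. I g \<omega> = 0"
  using white_noise by (simp add: complex_white_noise_integral_def Let_def)

lemma I_normal:
  "L2c g \<Longrightarrow> hermitian g \<Longrightarrow> (\<integral>l. (cmod (g l))\<^sup>2 \<partial>lborel) \<noteq> 0 \<Longrightarrow>
    distributed P lborel (\<lambda>\<omega>. Re (I g \<omega>)) (\<lambda>x. ennreal (normal_density 0 (sqrt (\<integral>l. (cmod (g l))\<^sup>2 \<partial>lborel)) x))"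
  using white_noise by (simp add: complex_white_noise_integral_def Let_def)

text \<open>The axioms control \<open>I\<close> only on Hermitian integrands, so the general case goes through the
  decomposition \<open>g = g\<^sub>1 + \<i> g\<^sub>2\<close> into Hermitian parts.\<close>
lemma I_AE_zero:
  assumes g: "L2c g" and z: "AE l in lborel. g l = 0"
  shows "AE \<omega> in P. I g \<omega> = 0"
proof -
  define g' where "g' = (\<lambda>l. cnj (g (- l)))"
  have g': "L2c g'" using L2c_reflect[OF g] by (simp add: g'_def)
  have z': "AE l in lborel. g' l = 0"
    using AE_borel_affine[of "-1" "\<lambda>l. g l = 0" 0] z L2c_measurable[OF g] by (simp add: g'_def)
  define g1 where "g1 = (\<lambda>l. (1/2) * g l + (1/2) * g' l)"
  define g2 where "g2 = (\<lambda>l. (1/(2*\<i>)) * g l + (-1/(2*\<i>)) * g' l)"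
  have L: "L2c g1" "L2c g2"
    unfolding g1_def g2_def by (intro L2c_add g g')+
  have H: "hermitian g1" "hermitian g2"
    by (auto simp: hermitian_def g1_def g2_def g'_def complex_eq_iff)
  have "AE l in lborel. (cmod (g1 l))\<^sup>2 = 0" "AE l in lborel. (cmod (g2 l))\<^sup>2 = 0"
    using z z' by (auto simp: g1_def g2_def)
  then have "(\<integral>l. (cmod (g1 l))\<^sup>2 \<partial>lborel) = 0" "(\<integral>l. (cmod (g2 l))\<^sup>2 \<partial>lborel) = 0"
    by (simp_all add: integral_eq_zero_AE)
  then have "AE \<omega> in P. I g1 \<omega> = 0" "AE \<omega> in P. I g2 \<omega> = 0"
    using I_null L H by auto
  moreover have "AE \<omega> in P. I (\<lambda>l. 1 * g1 l + \<i> * g2 l) \<omega> = 1 * I g1 \<omega> + \<i> * I g2 \<omega>"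
    by (rule I_add[OF L])
  moreover have "(\<lambda>l. 1 * g1 l + \<i> * g2 l) = g"
    by (auto simp: g1_def g2_def field_simps)
  ultimately show ?thesis by auto
qed

text \<open>\<open>I\<close> is a map on functions, and its axioms do not directly identify
  functions that agree almost everywhere; linearity applied to the difference reduces the claim to
  null integrands. This is what permits replacing \<open>f\<close> by an explicit version.\<close>

lemma I_cong_AE:
  assumes g: "L2c g" and h: "L2c h" and eq: "AE l in lborel. g l = h l"
  shows "AE \<omega> in P. I g \<omega> = I h \<omega>"
proof -
  have "AE \<omega> in P. I (\<lambda>l. 1 * g l + (-1) * h l) \<omega> = 0"
    by (rule I_AE_zero) (use eq L2c_add[OF g h, of 1 "-1"] in auto)
  moreover have "AE \<omega> in P. I (\<lambda>l. 1 * g l + (-1) * h l) \<omega> = 1 * I g \<omega> + (-1) * I h \<omega>"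
    by (rule I_add[OF g h])
  ultimately show ?thesis by auto
qed

lemma I_sum:
  "finite S \<Longrightarrow> (\<And>j. j \<in> S \<Longrightarrow> L2c (g j)) \<Longrightarrow>
    AE \<omega> in P. I (\<lambda>l. \<Sum>j\<in>S. a j * g j l) \<omega> = (\<Sum>j\<in>S. a j * I (g j) \<omega>)"
proof (induction S rule: finite_induct)
  case empty
  then show ?case using I_AE_zero[OF L2c_zero] by simp
next
  case (insert j S)
  then have "AE \<omega> in P. I (\<lambda>l. \<Sum>j\<in>S. a j * g j l) \<omega> = (\<Sum>j\<in>S. a j * I (g j) \<omega>)"
    by simp
  moreover have "AE \<omega> in P. I (\<lambda>l. a j * g j l + 1 * (\<Sum>j\<in>S. a j * g j l)) \<omega>
      = a j * I (g j) \<omega> + 1 * I (\<lambda>l. \<Sum>j\<in>S. a j * g j l) \<omega>"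
    using insert by (intro I_add L2c_sum) auto
  ultimately show ?case
    by eventually_elim (use insert(1,2) in simp)
qed

context
  fixes g assumes g: "L2c g" and herm: "hermitian g"
begin

text \<open>The five facts share the case distinction made by the axioms: for variance 0 there is no
  density and all follow from \<open>I g\<close> being 0 almost surely, otherwise they are read off
  from the normal density.\<close>

lemma I_integrable: "integrable P (\<lambda>\<omega>. Re (I g \<omega>))"
  and I_mean: "(\<integral>\<omega>. Re (I g \<omega>) \<partial>P) = 0"
  and I_square_integrable: "integrable P (\<lambda>\<omega>. (Re (I g \<omega>))\<^sup>2)"
  and I_variance: "(\<integral>\<omega>. (Re (I g \<omega>))\<^sup>2 \<partial>P) = (\<integral>l. (cmod (g l))\<^sup>2 \<partial>lborel)"
  and I_char: "(\<integral>\<omega>. cis (s * Re (I g \<omega>)) \<partial>P)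
    = complex_of_real (exp (- s\<^sup>2 * (\<integral>l. (cmod (g l))\<^sup>2 \<partial>lborel) / 2))"
proof -
  let ?v = "\<integral>l. (cmod (g l))\<^sup>2 \<partial>lborel"
  note [measurable] = measurable_I[OF g]
  have "integrable P (\<lambda>\<omega>. Re (I g \<omega>)) \<and> (\<integral>\<omega>. Re (I g \<omega>) \<partial>P) = 0 \<and>
    integrable P (\<lambda>\<omega>. (Re (I g \<omega>))\<^sup>2) \<and> (\<integral>\<omega>. (Re (I g \<omega>))\<^sup>2 \<partial>P) = ?v \<and>
    (\<integral>\<omega>. cis (s * Re (I g \<omega>)) \<partial>P) = complex_of_real (exp (- s\<^sup>2 * ?v / 2))"
  proof (cases "?v = 0")
    case True
    then have ae: "AE \<omega> in P. I g \<omega> = 0" using I_null[OF g herm] by simp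
    have "integrable P (\<lambda>\<omega>. Re (I g \<omega>)) \<longleftrightarrow> integrable P (\<lambda>\<omega>. 0::real)"
      using ae by (intro integrable_cong_AE) auto
    moreover have "integrable P (\<lambda>\<omega>. (Re (I g \<omega>))\<^sup>2) \<longleftrightarrow> integrable P (\<lambda>\<omega>. 0::real)"
      using ae by (intro integrable_cong_AE) auto
    moreover have "(\<integral>\<omega>. Re (I g \<omega>) \<partial>P) = (\<integral>\<omega>. 0 \<partial>P)"
      using ae by (intro integral_cong_AE) auto
    moreover have "(\<integral>\<omega>. (Re (I g \<omega>))\<^sup>2 \<partial>P) = (\<integral>\<omega>. 0 \<partial>P)"
      using ae by (intro integral_cong_AE) auto
    moreover have "(\<integral>\<omega>. cis (s * Re (I g \<omega>)) \<partial>P) = (\<integral>\<omega>. 1 \<partial>P)"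
      using ae by (intro integral_cong_AE) auto
    ultimately show ?thesis using True by (simp add: prob_space)
  next
    case False
    define \<sigma> where "\<sigma> = sqrt ?v"
    have \<sigma>: "\<sigma> > 0" "\<sigma>\<^sup>2 = ?v" using False by (simp_all add: \<sigma>_def order_less_le)
    have D: "distributed P lborel (\<lambda>\<omega>. Re (I g \<omega>)) (\<lambda>x. ennreal (normal_density 0 \<sigma> x))"
      using I_normal[OF g herm False] by (simp add: \<sigma>_def)
    have "integrable P (\<lambda>\<omega>. Re (I g \<omega>))"
      using distributed_integrable[OF D, of "\<lambda>x. x"] integrable_normal_moment[OF \<sigma>(1), of 0 1] by simp
    moreover have "(\<integral>\<omega>. Re (I g \<omega>) \<partial>P) = 0"
      by (rule normal_distributed_expectation[OF \<sigma>(1) D])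
    moreover have "integrable P (\<lambda>\<omega>. (Re (I g \<omega>))\<^sup>2)"
      using distributed_integrable[OF D, of "\<lambda>x. x\<^sup>2"] integrable_normal_moment[OF \<sigma>(1), of 0 2] by simp
    moreover have "(\<integral>\<omega>. (Re (I g \<omega>))\<^sup>2 \<partial>P) = ?v"
      using normal_distributed_variance[OF \<sigma>(1) D] \<sigma>(2) calculation by simp
    moreover have "(\<integral>\<omega>. cis (s * Re (I g \<omega>)) \<partial>P) = complex_of_real (exp (- s\<^sup>2 * ?v / 2))"
    proof -
      have "(\<integral>\<omega>. cis (s * Re (I g \<omega>)) \<partial>P) = (\<integral>x. cis (s * x) \<partial>distr P lborel (\<lambda>\<omega>. Re (I g \<omega>)))"
        by (subst integral_distr) auto
      also have "\<dots> = (\<integral>x. normal_density 0 \<sigma> x *\<^sub>R cis (s * x) \<partial>lborel)"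
        by (subst distributed_distr_eq_density[OF D], subst integral_density) auto
      also have "\<dots> = complex_of_real (exp (- s\<^sup>2 * ?v / 2))"
        unfolding integral_normal_density_cis[OF \<sigma>(1)] power_mult_distrib \<sigma>(2) by (simp add: mult.commute)
      finally show ?thesis .
    qed
    ultimately show ?thesis by blast
  qed
  then show "integrable P (\<lambda>\<omega>. Re (I g \<omega>))" "(\<integral>\<omega>. Re (I g \<omega>) \<partial>P) = 0"
    "integrable P (\<lambda>\<omega>. (Re (I g \<omega>))\<^sup>2)" "(\<integral>\<omega>. (Re (I g \<omega>))\<^sup>2 \<partial>P) = ?v"
    "(\<integral>\<omega>. cis (s * Re (I g \<omega>)) \<partial>P) = complex_of_real (exp (- s\<^sup>2 * ?v / 2))"
    by blast+
qed

lemma I_expectation: "(\<integral>\<omega>. I g \<omega> \<partial>P) = 0" "integrable P (I g)"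
proof -
  note [measurable] = measurable_I[OF g]
  have ae: "AE \<omega> in P. I g \<omega> = complex_of_real (Re (I g \<omega>))"
    using Im_I[OF g herm] by eventually_elim (simp add: complex_eq_iff)
  have "(\<integral>\<omega>. I g \<omega> \<partial>P) = (\<integral>\<omega>. complex_of_real (Re (I g \<omega>)) \<partial>P)"
    using ae by (intro integral_cong_AE) auto
  then show "(\<integral>\<omega>. I g \<omega> \<partial>P) = 0" using I_mean by simp
  have "integrable P (I g) \<longleftrightarrow> integrable P (\<lambda>\<omega>. complex_of_real (Re (I g \<omega>)))"
    using ae by (intro integrable_cong_AE) auto
  then show "integrable P (I g)" using I_integrable by simp
qed

end

text \<open>Polarisation: the axioms prescribe variances only, so the product is a quarter of the
  difference of the squares belonging to \<open>g + h\<close> and \<open>g - h\<close>. The same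
  identity for the moduli of the integrands yields the real part.\<close>

lemma I_covariance:
  assumes g: "L2c g" "hermitian g" and h: "L2c h" "hermitian h"
  shows "(\<integral>\<omega>. Re (I g \<omega>) * Re (I h \<omega>) \<partial>P) = (\<integral>l. Re (g l * cnj (h l)) \<partial>lborel)"
proof -
  note [measurable] = measurable_I[OF g(1)] measurable_I[OF h(1)] L2c_measurable[OF g(1)] L2c_measurable[OF h(1)]
  define q where "q = (\<lambda>l. 1 * g l + 1 * h l)"
  define r where "r = (\<lambda>l. 1 * g l + (-1) * h l)"
  have L: "L2c q" "L2c r" unfolding q_def r_def by (intro L2c_add g h)+
  have H: "hermitian q" "hermitian r" using g h by (auto simp: hermitian_def q_def r_def)
  note [measurable] = measurable_I[OF L(1)] measurable_I[OF L(2)]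
  have "AE \<omega> in P. I q \<omega> = 1 * I g \<omega> + 1 * I h \<omega>" "AE \<omega> in P. I r \<omega> = 1 * I g \<omega> + (-1) * I h \<omega>"
    unfolding q_def r_def by (intro I_add g h)+
  then have "AE \<omega> in P. Re (I g \<omega>) * Re (I h \<omega>) = ((Re (I q \<omega>))\<^sup>2 - (Re (I r \<omega>))\<^sup>2) / 4"
    by eventually_elim (simp add: power2_sum power2_diff)
  then have "(\<integral>\<omega>. Re (I g \<omega>) * Re (I h \<omega>) \<partial>P) = (\<integral>\<omega>. ((Re (I q \<omega>))\<^sup>2 - (Re (I r \<omega>))\<^sup>2) / 4 \<partial>P)"
    by (intro integral_cong_AE) auto
  also have "\<dots> = ((\<integral>l. (cmod (q l))\<^sup>2 \<partial>lborel) - (\<integral>l. (cmod (r l))\<^sup>2 \<partial>lborel)) / 4"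
    using I_square_integrable I_variance L H by simp
  also have "\<dots> = (\<integral>l. ((cmod (q l))\<^sup>2 - (cmod (r l))\<^sup>2) / 4 \<partial>lborel)"
    using L by (simp add: L2c_def)
  also have "\<dots> = (\<integral>l. Re (g l * cnj (h l)) \<partial>lborel)"
    by (intro Bochner_Integration.integral_cong refl)
      (simp add: q_def r_def cmod_power2, simp add: power2_eq_square algebra_simps)
  finally show ?thesis .
qed

end

section \<open>Gamma integrals\<close>

lemma Gamma_legendre_duplication_real:
  fixes x :: real
  assumes "x > 0"
  shows "Gamma x * Gamma (x + 1/2) = 2 powr (1 - 2 * x) * sqrt pi * Gamma (2 * x)"
proof -
  have nz: "complex_of_real y \<notin> \<int>\<^sub>\<le>\<^sub>0" if "y > 0" for y
    using that by (auto elim!: nonpos_Ints_cases simp: complex_eq_iff)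
  have "complex_of_real (Gamma x * Gamma (x + 1/2)) = Gamma (complex_of_real x) * Gamma (complex_of_real x + 1/2)"
    by (simp flip: Gamma_complex_of_real)
  also have "\<dots> = exp ((1 - 2 * complex_of_real x) * of_real (ln 2)) * of_real (sqrt pi) * Gamma (2 * complex_of_real x)"
    using assms nz[of x] nz[of "x + 1/2"] by (intro Gamma_legendre_duplication) auto
  also have "\<dots> = complex_of_real (exp ((1 - 2 * x) * ln 2) * sqrt pi * Gamma (2 * x))"
    by (simp flip: Gamma_complex_of_real exp_of_real)
  also have "exp ((1 - 2 * x) * ln 2) = 2 powr (1 - 2 * x)"
    by (simp add: powr_def)
  finally show ?thesis by (simp only: of_real_eq_iff)
qed

lemma Gamma_reflection_real: "Gamma x * Gamma (1 - x) = pi / sin (pi * x)" for x :: real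
proof -
  have "complex_of_real (Gamma x * Gamma (1 - x)) = Gamma (complex_of_real x) * Gamma (1 - complex_of_real x)"
    by (simp flip: Gamma_complex_of_real)
  also have "\<dots> = complex_of_real (pi / sin (pi * x))"
    by (simp add: Gamma_reflection_complex flip: sin_of_real)
  finally show ?thesis by (simp only: of_real_eq_iff)
qed

text \<open>The form in which the constant comes out of the Gamma integral at the origin.
  Duplication at \<open>\<kappa> / 2\<close> removes \<open>Gamma \<kappa>\<close>, reflection at
  \<open>(1 - \<kappa>) / 2\<close> removes the cosine, and the common factor
  \<open>Gamma (\<kappa> / 2 + 1/2)\<close> cancels.\<close>

lemma c2_altdef:
  assumes "0 < \<kappa>" "\<kappa> < 1"
  shows "c2 \<kappa> = 2 powr (- \<kappa>) * Gamma ((1 - \<kappa>) / 2) / (sqrt pi * Gamma (\<kappa> / 2))"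
proof -
  have "cos (\<kappa> * pi / 2) > 0"
    using assms by (intro cos_gt_zero_pi) (auto simp: field_simps intro: order.strict_trans2[of _ 0])
  moreover have G: "Gamma \<kappa> > 0" "Gamma (\<kappa> / 2) > 0" "Gamma (\<kappa> / 2 + 1/2) > 0"
    using assms by (auto intro!: Gamma_real_pos)
  moreover have "Gamma (\<kappa> / 2) * Gamma (\<kappa> / 2 + 1/2) = 2 powr (1 - \<kappa>) * sqrt pi * Gamma \<kappa>"
    using Gamma_legendre_duplication_real[of "\<kappa> / 2"] assms by simp
  moreover have "Gamma ((1 - \<kappa>) / 2) * Gamma (\<kappa> / 2 + 1/2) = pi / cos (\<kappa> * pi / 2)"
  proof -
    have "sin (pi * ((1 - \<kappa>) / 2)) = cos (\<kappa> * pi / 2)"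
      by (subst cos_sin_eq) (simp add: field_simps)
    moreover have "1 - (1 - \<kappa>) / 2 = \<kappa> / 2 + 1/2" by (simp add: field_simps)
    ultimately show ?thesis using Gamma_reflection_real[of "(1 - \<kappa>) / 2"] by simp
  qed
  moreover have "2 powr (1 - \<kappa>) = 2 * 2 powr (- \<kappa>)"
    by (simp add: powr_diff powr_minus divide_inverse)
  ultimately show ?thesis
    unfolding c2_def
  proof -
    let ?c = "cos (\<kappa> * pi / 2)" and ?a = "Gamma (\<kappa> / 2)" and ?b = "Gamma (\<kappa> / 2 + 1/2)" and ?p = "2 powr (- \<kappa>)"
    assume *: "?c > 0" "Gamma \<kappa> > 0" "?a > 0" "?b > 0"
      "?a * ?b = 2 powr (1 - \<kappa>) * sqrt pi * Gamma \<kappa>"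
      "Gamma ((1 - \<kappa>) / 2) * ?b = pi / ?c" "2 powr (1 - \<kappa>) = 2 * ?p"
    have p: "?p > 0" by simp
    have g: "Gamma ((1 - \<kappa>) / 2) = pi / (?c * ?b)"
      using * by (simp add: field_simps)
    have b: "?b = 2 * ?p * sqrt pi * Gamma \<kappa> / ?a"
      using * by (simp add: field_simps)
    have "?p * Gamma ((1 - \<kappa>) / 2) / (sqrt pi * ?a) = ?p * pi / (?c * (?b * ?a) * sqrt pi)"
      unfolding g by (simp add: mult_ac)
    also have "?b * ?a = 2 * ?p * sqrt pi * Gamma \<kappa>"
      using * by (simp add: mult_ac)
    also have "?p * pi / (?c * (2 * ?p * sqrt pi * Gamma \<kappa>) * sqrt pi) = ?p * pi / (?p * (sqrt pi * sqrt pi) * (2 * Gamma \<kappa> * ?c))"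
      by (simp only: mult_ac)
    also have "sqrt pi * sqrt pi = pi" by simp
    also have "?p * pi / (?p * pi * (2 * Gamma \<kappa> * ?c)) = 1 / (2 * Gamma \<kappa> * ?c)"
      using p by simp
    finally show "1 / (2 * Gamma \<kappa> * ?c) = ?p * Gamma ((1 - \<kappa>) / 2) / (sqrt pi * ?a)" by simp
  qed
qed

text \<open>Common source of the three Gamma integrals below, with \<open>g x\<close> equal to
  \<open>c * x\<close>, \<open>\<tau> * x ^ m\<close> and \<open>1 / (4 * x)\<close>. The change of
  variables is carried out for \<open>lebesgue\<close>; Borel measurability of the integrand then
  carries the value over to \<open>lborel\<close>.\<close>

lemma Gamma_integral_substitution:
  fixes g :: "real \<Rightarrow> real"
  assumes s: "s > 0"
    and der: "\<And>x. x > 0 \<Longrightarrow> (g has_real_derivative g' x) (at x)"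
    and inj: "inj_on g {0<..}" and im: "g ` {0<..} = {0<..}"
    and [measurable]: "g \<in> borel_measurable borel" "g' \<in> borel_measurable borel"
  shows "has_bochner_integral lborel (\<lambda>x. indicator {0<..} x * (\<bar>g' x\<bar> * (g x powr (s - 1) * exp (- g x)))) (Gamma s)"
proof -
  let ?f = "\<lambda>t::real. t powr (s - 1) * exp (- t)"
  let ?h = "\<lambda>x. \<bar>g' x\<bar> * ?f (g x)"
  have "((\<lambda>t. t powr (s - 1) / exp t) has_integral Gamma s) {0<..}"
    using Gamma_integral_real[OF s]
    by (subst has_integral_spike_set_eq[where T = "{0..}"]) (auto intro: negligible_subset[of "{0}"])
  then have hi: "(?f has_integral Gamma s) {0<..}"
    by (simp add: exp_minus field_simps)
  have "?f absolutely_integrable_on {0<..}"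
    using hi by (intro nonnegative_absolutely_integrable_1) auto
  then have "?f absolutely_integrable_on g ` {0<..} \<and> integral (g ` {0<..}) ?f = Gamma s"
    using hi im by (simp add: integral_unique)
  then have "?h absolutely_integrable_on {0<..} \<and> integral {0<..} ?h = Gamma s"
    by (subst has_absolute_integral_change_of_variables_1')
      (use der inj in \<open>auto intro: has_field_derivative_at_within\<close>)
  then have "set_integrable lebesgue {0<..} ?h" "(LINT x:{0<..}|lebesgue. ?h x) = Gamma s"
    by (auto simp: set_lebesgue_integral_eq_integral)
  moreover have "(\<lambda>x. indicator {0<..} x *\<^sub>R ?h x) \<in> borel_measurable lborel"
    by measurable
  ultimately show ?thesis
    unfolding set_integrable_def set_lebesgue_integral_def has_bochner_integral_iff
    by (simp add: integrable_completion integral_completion)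
qed

lemma Gamma_integral_scaled:
  fixes s c :: real
  assumes "s > 0" "c > 0"
  shows "has_bochner_integral lborel (\<lambda>x. indicator {0<..} x * (x powr (s - 1) * exp (- c * x))) (Gamma s * c powr (- s))"
proof -
  have "(\<lambda>x. c * x) ` {0<..} = {0<..}"
    using assms by (auto simp: image_iff intro!: bexI[of _ "_ / c"])
  then have "has_bochner_integral lborel (\<lambda>x. indicator {0<..} x * (\<bar>c\<bar> * ((c * x) powr (s - 1) * exp (- (c * x))))) (Gamma s)"
    using assms by (intro Gamma_integral_substitution) (auto simp: inj_on_def intro!: derivative_eq_intros)
  then have "has_bochner_integral lborel (\<lambda>x. c powr (- s) * (indicator {0<..} x * (\<bar>c\<bar> * ((c * x) powr (s - 1) * exp (- (c * x)))))) (c powr (- s) * Gamma s)"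
    by (intro has_bochner_integral_mult_right) auto
  moreover have "c powr (- s) * (indicator {0<..} x * (\<bar>c\<bar> * ((c * x) powr (s - 1) * exp (- (c * x)))))
      = indicator {0<..} x * (x powr (s - 1) * exp (- c * x))" for x
  proof (cases "x > 0")
    case True
    have "c powr (- s) * c * c powr (s - 1) = 1"
      using assms by (simp add: powr_diff powr_minus)
    then show ?thesis
      using True assms by (simp add: powr_mult mult_ac)
  qed simp
  ultimately show ?thesis by (simp only: mult.commute[of "Gamma s"])
qed

lemma Gamma_integral_power:
  fixes s \<tau> :: real
  assumes s: "s > 0" and \<tau>: "\<tau> > 0" and m: "m > 0"
  shows "has_bochner_integral lborel (\<lambda>x. indicator {0<..} x * (x powr (s - 1) * exp (- \<tau> * x ^ m)))
    (Gamma (s / real m) * \<tau> powr (- (s / real m)) / real m)"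
proof -
  define a where "a = s / real m"
  have a: "a > 0" using s m by (simp add: a_def)
  have im: "(\<lambda>x. \<tau> * x ^ m) ` {0<..} = {0<..}"
  proof (intro equalityI subsetI)
    fix y :: real assume y: "y \<in> {0<..}"
    have "y = \<tau> * (root m (y / \<tau>)) ^ m" "root m (y / \<tau>) > 0"
      using y \<tau> m by auto
    then show "y \<in> (\<lambda>x. \<tau> * x ^ m) ` {0<..}" by blast
  qed (use \<tau> in auto)
  have "has_bochner_integral lborel (\<lambda>x. indicator {0<..} x * (\<bar>\<tau> * (real m * x ^ (m - 1))\<bar> * ((\<tau> * x ^ m) powr (a - 1) * exp (- (\<tau> * x ^ m))))) (Gamma a)"
    using a im \<tau> m
    by (intro Gamma_integral_substitution) (auto simp: inj_on_def power_eq_iff_eq_base intro!: derivative_eq_intros)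
  then have "has_bochner_integral lborel (\<lambda>x. (\<tau> powr (- a) / real m) * (indicator {0<..} x * (\<bar>\<tau> * (real m * x ^ (m - 1))\<bar> * ((\<tau> * x ^ m) powr (a - 1) * exp (- (\<tau> * x ^ m)))))) ((\<tau> powr (- a) / real m) * Gamma a)"
    by (intro has_bochner_integral_mult_right) auto
  moreover have "(\<tau> powr (- a) / real m) * (indicator {0<..} x * (\<bar>\<tau> * (real m * x ^ (m - 1))\<bar> * ((\<tau> * x ^ m) powr (a - 1) * exp (- (\<tau> * x ^ m)))))
      = indicator {0<..} x * (x powr (s - 1) * exp (- \<tau> * x ^ m))" for x
  proof (cases "x > 0")
    case True
    have 1: "\<tau> powr (- a) * \<tau> * \<tau> powr (a - 1) = 1"
      using \<tau> by (simp add: powr_diff powr_minus)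
    have "x ^ (m - 1) * (x ^ m) powr (a - 1) = x powr (real (m - 1) + real m * (a - 1))"
      using True by (simp add: powr_add powr_realpow[symmetric] powr_powr)
    also have "real (m - 1) + real m * (a - 1) = s - 1"
      using m by (simp add: a_def field_simps of_nat_diff)
    finally have 2: "x ^ (m - 1) * (x ^ m) powr (a - 1) = x powr (s - 1)" .
    have "(\<tau> powr (- a) / real m) * (\<bar>\<tau> * (real m * x ^ (m - 1))\<bar> * ((\<tau> * x ^ m) powr (a - 1)))
       = (\<tau> powr (- a) * \<tau> * \<tau> powr (a - 1)) * (x ^ (m - 1) * (x ^ m) powr (a - 1))"
      using True \<tau> m by (simp add: powr_mult)
    then show ?thesis
      using True by (simp add: 1 2[simplified] mult.assoc[symmetric])
  qed simp
  ultimately show ?thesis by (simp add: a_def mult.commute)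
qed

text \<open>Inversion turns decay at infinity into decay at 0. The 4 stems from the normal density
  in \<open>gamma_normal\<close>: with variance 2 s its exponent is -l^2 / (4 s), which becomes -1 /
  (4 u) for s = l^2 u.\<close>

lemma Gamma_integral_inverse:
  fixes s :: real
  assumes s: "s > 0"
  shows "has_bochner_integral lborel (\<lambda>x. indicator {0<..} x * (x powr (- s - 1) * exp (- 1 / (4 * x)))) (4 powr s * Gamma s)"
proof -
  have im: "(\<lambda>x::real. 1 / (4 * x)) ` {0<..} = {0<..}"
  proof (intro equalityI subsetI)
    fix y :: real assume "y \<in> {0<..}"
    then have "y = 1 / (4 * (1 / (4 * y)))" "1 / (4 * y) > 0" by auto
    then show "y \<in> (\<lambda>x. 1 / (4 * x)) ` {0<..}" by blast
  qed auto
  have "has_bochner_integral lborel (\<lambda>x. indicator {0<..} x * (\<bar>- 1 / (4 * x\<^sup>2)\<bar> * ((1 / (4 * x)) powr (s - 1) * exp (- (1 / (4 * x)))))) (Gamma s)"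
    using s im
    by (intro Gamma_integral_substitution)
      (auto simp: inj_on_def power2_eq_square intro!: derivative_eq_intros)
  then have "has_bochner_integral lborel (\<lambda>x. 4 powr s * (indicator {0<..} x * (\<bar>- 1 / (4 * x\<^sup>2)\<bar> * ((1 / (4 * x)) powr (s - 1) * exp (- (1 / (4 * x))))))) (4 powr s * Gamma s)"
    by (intro has_bochner_integral_mult_right) auto
  moreover have "4 powr s * (indicator {0<..} x * (\<bar>- 1 / (4 * x\<^sup>2)\<bar> * ((1 / (4 * x)) powr (s - 1) * exp (- (1 / (4 * x))))))
      = indicator {0<..} x * (x powr (- s - 1) * exp (- 1 / (4 * x)))" for x :: real
  proof (cases "x > 0")
    case True
    have 1: "(1 / (4 * x)) powr (s - 1) = 4 powr (1 - s) * x powr (1 - s)"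
      using True by (simp add: powr_divide powr_mult powr_diff field_simps)
    have 2: "4 powr s * 4 powr (1 - s) = (4::real)"
      by (simp add: powr_diff)
    have 3: "x powr (- s - 1) = x powr (1 - s) / x\<^sup>2"
      using True by (simp add: powr_diff powr_minus field_simps power2_eq_square)
    have "4 powr s * (\<bar>- 1 / (4 * x\<^sup>2)\<bar> * (1 / (4 * x)) powr (s - 1)) = (4 powr s * 4 powr (1 - s)) / 4 * (x powr (1 - s) / x\<^sup>2)"
      unfolding 1 using True by simp
    also have "\<dots> = x powr (- s - 1)"
      unfolding 2 3 by simp
    finally have "4 powr s * (\<bar>- 1 / (4 * x\<^sup>2)\<bar> * (1 / (4 * x)) powr (s - 1)) * exp (- (1 / (4 * x)))
        = x powr (- s - 1) * exp (- 1 / (4 * x))" by simp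
    then show ?thesis
      using True by (simp only: mult.assoc) simp
  qed simp
  ultimately show ?thesis by simp
qed

section \<open>The spectral density\<close>

text \<open>Up to the factor \<open>Gamma (\<kappa> / 2)\<close>, the joint density of a Gamma
  variable \<open>s\<close> and, given \<open>s\<close>, a centred normal \<open>l\<close>. The
  variance \<open>2 * s\<close> is chosen so that the conditional characteristic function is
  exp(-x^2 s).\<close>

definition gamma_normal :: "real \<Rightarrow> real \<times> real \<Rightarrow> real" where
  "gamma_normal \<kappa> = (\<lambda>(s, l). indicator {0<..} s * (s powr (\<kappa> / 2 - 1) * exp (- s) * normal_density 0 (sqrt (2 * s)) l))"

text \<open>The spectral density of \<open>(1 + x\<^sup>2)\<^bsup>-\<kappa>/2\<^esup>\<close>, i.e. \<open>c\<^sub>1(\<kappa>) K\<^bsub>(\<kappa>-1)/2\<^esub>(|l|) |l|\<^bsup>(\<kappa>-1)/2\<^esup>\<close>,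
  as a Gamma mixture of normal densities.\<close>
definition bessel_density :: "real \<Rightarrow> real \<Rightarrow> real" where
  "bessel_density \<kappa> l = (\<integral>s. gamma_normal \<kappa> (s, l) \<partial>lborel) / Gamma (\<kappa> / 2)"

text \<open>What remains of \<open>bessel_density\<close> after the substitution s = l^2 u has
  pulled out the power \<open>\<bar>l\<bar> powr (\<kappa> - 1)\<close>. Unlike the density itself,
  it is finite and continuous at the origin.\<close>

definition bessel_factor :: "real \<Rightarrow> real \<Rightarrow> real" where
  "bessel_factor \<kappa> l = (\<integral>u. indicator {0<..} u * (u powr ((\<kappa> - 1) / 2 - 1) * exp (- 1 / (4 * u))) * exp (- (l\<^sup>2 * u)) \<partial>lborel)
     / (2 * sqrt pi * Gamma (\<kappa> / 2))"

lemma gamma_normal_measurable [measurable]: "gamma_normal \<kappa> \<in> borel_measurable (lborel \<Otimes>\<^sub>M lborel)"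
proof -
  have "gamma_normal \<kappa> = (\<lambda>p. indicator {0<..} (fst p) * (fst p powr (\<kappa> / 2 - 1) * exp (- fst p) *
      (1 / sqrt (2 * pi * (sqrt (2 * fst p))\<^sup>2) * exp (- (snd p - 0)\<^sup>2 / (2 * (sqrt (2 * fst p))\<^sup>2)))))"
    by (auto simp: gamma_normal_def normal_density_def)
  then show ?thesis by simp
qed

lemma gamma_normal_nonneg: "gamma_normal \<kappa> p \<ge> 0"
  by (auto simp: gamma_normal_def split: prod.split)

context
  fixes \<kappa> :: real
  assumes \<kappa>: "0 < \<kappa>" "\<kappa> < 1"
begin

lemma Gamma_half_pos: "Gamma (\<kappa> / 2) > 0"
  using \<kappa> by (intro Gamma_real_pos) simp

lemma integral_gamma_normal_cis:
  "(\<integral>l. gamma_normal \<kappa> (s, l) *\<^sub>R cis (x * l) \<partial>lborel)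
    = of_real (indicator {0<..} s * (s powr (\<kappa> / 2 - 1) * exp (- (1 + x\<^sup>2) * s)))"
proof (cases "s > 0")
  case True
  then have "(\<integral>l. gamma_normal \<kappa> (s, l) *\<^sub>R cis (x * l) \<partial>lborel)
      = (\<integral>l. (s powr (\<kappa> / 2 - 1) * exp (- s)) *\<^sub>R (normal_density 0 (sqrt (2 * s)) l *\<^sub>R cis (x * l)) \<partial>lborel)"
    by (simp add: gamma_normal_def)
  also have "\<dots> = (s powr (\<kappa> / 2 - 1) * exp (- s)) *\<^sub>R complex_of_real (exp (- (sqrt (2 * s) * x)\<^sup>2 / 2))"
    by (simp only: integral_scaleR_right integral_normal_density_cis[of "sqrt (2 * s)"] True real_sqrt_gt_zero
        mult_pos_pos zero_less_numeral)
  also have "- (sqrt (2 * s) * x)\<^sup>2 / 2 = - (x\<^sup>2 * s)"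
    using True by (simp add: power_mult_distrib)
  also have "(s powr (\<kappa> / 2 - 1) * exp (- s)) *\<^sub>R complex_of_real (exp (- (x\<^sup>2 * s)))
      = of_real (s powr (\<kappa> / 2 - 1) * (exp (- s) * exp (- (x\<^sup>2 * s))))"
    by (simp add: scaleR_conv_of_real)
  also have "exp (- s) * exp (- (x\<^sup>2 * s)) = exp (- (1 + x\<^sup>2) * s)"
    unfolding exp_add[symmetric] by (simp add: algebra_simps)
  finally show ?thesis using True by simp
qed (simp add: gamma_normal_def)

text \<open>Integrating the normal variable first leaves the Gamma integrand, whose integral is
  finite because \<open>\<kappa>\<close> is positive.\<close>

lemma integrable_gamma_normal: "integrable (lborel \<Otimes>\<^sub>M lborel) (gamma_normal \<kappa>)"
proof (rule lborel_pair.Fubini_integrable)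
  have "(\<integral>l. norm (gamma_normal \<kappa> (s, l)) \<partial>lborel) = indicator {0<..} s * (s powr (\<kappa> / 2 - 1) * exp (- 1 * s))" for s
    by (cases "s > 0") (auto simp: gamma_normal_def integral_normal_density[of "sqrt (2 * s)"])
  then show "integrable lborel (\<lambda>s. \<integral>l. norm (gamma_normal \<kappa> (s, l)) \<partial>lborel)"
    using Gamma_integral_scaled[of "\<kappa> / 2" 1] \<kappa> by (simp add: has_bochner_integral_iff)
  have "integrable lborel (\<lambda>l. gamma_normal \<kappa> (s, l))" for s
    by (cases "s > 0") (auto simp: gamma_normal_def)
  then show "AE s in lborel. integrable lborel (\<lambda>l. gamma_normal \<kappa> (s, l))" by simp
qed measurable

lemma bessel_density_nonneg: "bessel_density \<kappa> l \<ge> 0"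
  unfolding bessel_density_def
  using Gamma_half_pos by (intro divide_nonneg_pos Bochner_Integration.integral_nonneg gamma_normal_nonneg) auto

lemma bessel_density_even: "bessel_density \<kappa> (- l) = bessel_density \<kappa> l"
  by (simp add: bessel_density_def gamma_normal_def normal_density_def)

lemma integrable_bessel_density: "integrable lborel (bessel_density \<kappa>)"
  using lborel_pair.integrable_snd[of "\<lambda>s l. gamma_normal \<kappa> (s, l)"] integrable_gamma_normal
  by (simp add: bessel_density_def[abs_def])

text \<open>By Fubini the normal variable is integrated first. It turns \<open>cis\<close> into
  exp(-x^2 s), which raises the rate of the Gamma integral from 1 to
  \<open>1 + x\<^sup>2\<close>.\<close>

lemma bessel_density_fourier:
  "(\<integral>l. bessel_density \<kappa> l *\<^sub>R cis (x * l) \<partial>lborel) = of_real (1 / (1 + x\<^sup>2) powr (\<kappa> / 2))"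
proof -
  have int: "integrable (lborel \<Otimes>\<^sub>M lborel) (\<lambda>(s, l). gamma_normal \<kappa> (s, l) *\<^sub>R cis (x * l))"
  proof (rule Bochner_Integration.integrable_bound[OF integrable_gamma_normal])
    have "(\<lambda>(s, l). gamma_normal \<kappa> (s, l) *\<^sub>R cis (x * l)) = (\<lambda>p. gamma_normal \<kappa> p *\<^sub>R cis (x * snd p))"
      by auto
    then show "(\<lambda>(s, l). gamma_normal \<kappa> (s, l) *\<^sub>R cis (x * l)) \<in> borel_measurable (lborel \<Otimes>\<^sub>M lborel)"
      by simp
  qed (auto split: prod.split)
  have pos: "1 + x\<^sup>2 > 0" by (simp add: add_pos_nonneg)
  have "(\<integral>l. bessel_density \<kappa> l *\<^sub>R cis (x * l) \<partial>lborel)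
      = (\<integral>l. (1 / Gamma (\<kappa> / 2)) *\<^sub>R (\<integral>s. gamma_normal \<kappa> (s, l) *\<^sub>R cis (x * l) \<partial>lborel) \<partial>lborel)"
  proof (rule Bochner_Integration.integral_cong_AE)
    \<comment> \<open>Pulling \<open>cis\<close> under the inner integral uses integrability of the
      section, which fails at \<open>l = 0\<close> but holds almost everywhere.\<close>
    show "AE l in lborel. bessel_density \<kappa> l *\<^sub>R cis (x * l)
        = (1 / Gamma (\<kappa> / 2)) *\<^sub>R (\<integral>s. gamma_normal \<kappa> (s, l) *\<^sub>R cis (x * l) \<partial>lborel)"
      using lborel_pair.AE_integrable_snd[of "\<lambda>s l. gamma_normal \<kappa> (s, l)"] integrable_gamma_normal
      by (auto simp: bessel_density_def elim!: eventually_mono)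
    show "(\<lambda>l. bessel_density \<kappa> l *\<^sub>R cis (x * l)) \<in> borel_measurable lborel"
      using borel_measurable_integrable[OF integrable_bessel_density] by simp
    show "(\<lambda>l. (1 / Gamma (\<kappa> / 2)) *\<^sub>R (\<integral>s. gamma_normal \<kappa> (s, l) *\<^sub>R cis (x * l) \<partial>lborel)) \<in> borel_measurable lborel"
      using borel_measurable_integrable[OF lborel_pair.integrable_snd[OF int]] by simp
  qed
  also have "\<dots> = (1 / Gamma (\<kappa> / 2)) *\<^sub>R (\<integral>s. (\<integral>l. gamma_normal \<kappa> (s, l) *\<^sub>R cis (x * l) \<partial>lborel) \<partial>lborel)"
    unfolding integral_scaleR_right by (subst lborel_pair.Fubini_integral[OF int]) simp
  also have "\<dots> = (1 / Gamma (\<kappa> / 2)) *\<^sub>R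
      complex_of_real (\<integral>s. indicator {0<..} s * (s powr (\<kappa> / 2 - 1) * exp (- (1 + x\<^sup>2) * s)) \<partial>lborel)"
    unfolding integral_gamma_normal_cis integral_complex_of_real ..
  also have "(\<integral>s. indicator {0<..} s * (s powr (\<kappa> / 2 - 1) * exp (- (1 + x\<^sup>2) * s)) \<partial>lborel)
      = Gamma (\<kappa> / 2) * (1 + x\<^sup>2) powr (- (\<kappa> / 2))"
    using Gamma_integral_scaled[of "\<kappa> / 2" "1 + x\<^sup>2"] \<kappa> pos by (simp only: has_bochner_integral_iff)
  finally show ?thesis
    using Gamma_half_pos by (simp add: scaleR_conv_of_real powr_minus_divide)
qed

text \<open>At \<open>l = 0\<close> the integral is the inverse Gamma integral with parameter
  \<open>(1 - \<kappa>) / 2\<close>, positive because \<open>\<kappa> < 1\<close>. Its integrand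
  also serves as the dominating function for all other \<open>l\<close>.\<close>

lemma bessel_factor_integrable:
  "integrable lborel (\<lambda>u. indicator {0<..} u * (u powr ((\<kappa> - 1) / 2 - 1) * exp (- 1 / (4 * u))))"
  and bessel_factor_0: "bessel_factor \<kappa> 0 = c2 \<kappa>"
proof -
  define s where "s = (1 - \<kappa>) / 2"
  have *: "has_bochner_integral lborel (\<lambda>x. indicator {0<..} x * (x powr (- s - 1) * exp (- 1 / (4 * x)))) (4 powr s * Gamma s)"
    by (rule Gamma_integral_inverse) (use \<kappa> in \<open>simp add: s_def\<close>)
  have s: "- s - 1 = (\<kappa> - 1) / 2 - 1" by (simp add: s_def field_simps)
  show "integrable lborel (\<lambda>u. indicator {0<..} u * (u powr ((\<kappa> - 1) / 2 - 1) * exp (- 1 / (4 * u))))"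
    using * unfolding s by (simp add: has_bochner_integral_iff)
  have "(4::real) powr s = 2 powr (1 - \<kappa>)"
    using powr_powr[of 2 2 s] by (simp add: s_def)
  also have "\<dots> = 2 * 2 powr (- \<kappa>)" by (simp add: powr_diff powr_minus divide_inverse)
  finally have p: "4 powr s = 2 * 2 powr (- \<kappa>)" .
  have "bessel_factor \<kappa> 0 = 4 powr s * Gamma s / (2 * sqrt pi * Gamma (\<kappa> / 2))"
    using * unfolding s by (simp add: has_bochner_integral_iff bessel_factor_def)
  then show "bessel_factor \<kappa> 0 = c2 \<kappa>"
    unfolding c2_altdef[OF \<kappa>] p by (simp add: s_def)
qed

text \<open>The factor \<open>exp (- (l\<^sup>2 * u))\<close> is at most 1, so the integral is
  largest at the origin.\<close>

lemma bessel_factor_le: "bessel_factor \<kappa> l \<le> c2 \<kappa>"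
  and bessel_factor_nonneg: "0 \<le> bessel_factor \<kappa> l"
proof -
  let ?F = "\<lambda>u::real. indicator {0<..} u * (u powr ((\<kappa> - 1) / 2 - 1) * exp (- 1 / (4 * u)))"
  have le: "?F u * exp (- (l\<^sup>2 * u)) \<le> ?F u" "0 \<le> ?F u * exp (- (l\<^sup>2 * u))" for u
    by (cases "u > 0"; simp add: mult_le_cancel_left1)+
  have [measurable]: "?F \<in> borel_measurable borel" by simp
  have "integrable lborel (\<lambda>u. ?F u * exp (- (l\<^sup>2 * u)))"
  proof (rule Bochner_Integration.integrable_bound[OF bessel_factor_integrable])
    show "(\<lambda>u. ?F u * exp (- (l\<^sup>2 * u))) \<in> borel_measurable lborel" by measurable
    show "AE u in lborel. norm (?F u * exp (- (l\<^sup>2 * u))) \<le> norm (?F u)"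
      unfolding real_norm_def
    proof (intro always_eventually allI)
      fix u show "\<bar>?F u * exp (- (l\<^sup>2 * u))\<bar> \<le> \<bar>?F u\<bar>"
        using le[of u] by linarith
    qed
  qed
  then have "(\<integral>u. ?F u * exp (- (l\<^sup>2 * u)) \<partial>lborel) \<le> (\<integral>u. ?F u \<partial>lborel)"
    using le bessel_factor_integrable by (intro integral_mono) auto
  then have "bessel_factor \<kappa> l \<le> bessel_factor \<kappa> 0"
    unfolding bessel_factor_def using Gamma_half_pos by (intro divide_right_mono) auto
  then show "bessel_factor \<kappa> l \<le> c2 \<kappa>" by (simp add: bessel_factor_0)
  show "0 \<le> bessel_factor \<kappa> l"
    unfolding bessel_factor_def using Gamma_half_pos le(2) by (intro divide_nonneg_pos Bochner_Integration.integral_nonneg) auto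
qed

lemma c2_nonneg: "c2 \<kappa> \<ge> 0"
  using bessel_factor_le[of 0] bessel_factor_nonneg[of 0] by linarith

lemma bessel_factor_tendsto:
  assumes "X \<longlonglongrightarrow> 0"
  shows "(\<lambda>i. bessel_factor \<kappa> (X i)) \<longlonglongrightarrow> c2 \<kappa>"
proof -
  let ?F = "\<lambda>u::real. indicator {0<..} u * (u powr ((\<kappa> - 1) / 2 - 1) * exp (- 1 / (4 * u)))"
  have [measurable]: "?F \<in> borel_measurable borel" by simp
  have "(\<lambda>i. \<integral>u. ?F u * exp (- ((X i)\<^sup>2 * u)) \<partial>lborel) \<longlonglongrightarrow> (\<integral>u. ?F u * exp (- (0\<^sup>2 * u)) \<partial>lborel)"
  proof (rule integral_dominated_convergence[OF _ _ bessel_factor_integrable])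
    show "AE u in lborel. (\<lambda>i. ?F u * exp (- ((X i)\<^sup>2 * u))) \<longlonglongrightarrow> ?F u * exp (- (0\<^sup>2 * u))"
      by (intro always_eventually allI tendsto_intros assms)
    show "AE u in lborel. norm (?F u * exp (- ((X i)\<^sup>2 * u))) \<le> ?F u" for i
    proof (intro always_eventually allI)
      show "norm (?F u * exp (- ((X i)\<^sup>2 * u))) \<le> ?F u" for u
        by (cases "u > 0") (auto simp: abs_mult mult_le_cancel_left1)
    qed
  qed simp_all
  then have "(\<lambda>i. bessel_factor \<kappa> (X i)) \<longlonglongrightarrow> bessel_factor \<kappa> 0"
    unfolding bessel_factor_def using Gamma_half_pos by (intro tendsto_divide) auto
  then show ?thesis by (simp add: bessel_factor_0)
qed

text \<open>Under s = l^2 u the Gamma weight contributes |l|^(kappa - 2), the height of the normal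
  density 1 / |l| and the Jacobian l^2, which multiply to |l|^(kappa - 1), while the exponent of the
  normal density becomes free of \<open>l\<close>.\<close>

lemma bessel_density_eq:
  assumes "l \<noteq> 0"
  shows "bessel_density \<kappa> l = \<bar>l\<bar> powr (\<kappa> - 1) * bessel_factor \<kappa> l"
proof -
  have l2: "l\<^sup>2 > 0" using assms by simp
  let ?F = "\<lambda>u::real. indicator {0<..} u * (u powr ((\<kappa> - 1) / 2 - 1) * exp (- 1 / (4 * u)))"
  \<comment> \<open>The argument \<open>0 + l\<^sup>2 * u\<close> has the shape produced by the
    affine substitution on \<open>lborel\<close>.\<close>
  have eq: "gamma_normal \<kappa> (0 + l\<^sup>2 * u, l) * l\<^sup>2 = \<bar>l\<bar> powr (\<kappa> - 1) / (2 * sqrt pi) * (?F u * exp (- (l\<^sup>2 * u)))" for u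
  proof (cases "u > 0")
    case True
    have 1: "(l\<^sup>2 * u) powr (\<kappa> / 2 - 1) = \<bar>l\<bar> powr (\<kappa> - 2) * u powr (\<kappa> / 2 - 1)"
    proof -
      have "(l\<^sup>2) powr (\<kappa> / 2 - 1) = (\<bar>l\<bar> powr 2) powr (\<kappa> / 2 - 1)"
        using assms by simp
      also have "\<dots> = \<bar>l\<bar> powr (\<kappa> - 2)"
        unfolding powr_powr by (simp add: right_diff_distrib)
      finally show ?thesis using True by (simp add: powr_mult)
    qed
    have 2: "normal_density 0 (sqrt (2 * (l\<^sup>2 * u))) l = 1 / (2 * sqrt pi * \<bar>l\<bar> * sqrt u) * exp (- 1 / (4 * u))"
    proof -
      have "sqrt (2 * pi * (2 * (l\<^sup>2 * u))) = sqrt (2\<^sup>2 * (pi * (l\<^sup>2 * u)))"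
        by (simp add: mult_ac)
      also have "\<dots> = 2 * sqrt pi * \<bar>l\<bar> * sqrt u"
        by (simp add: real_sqrt_mult)
      finally have "sqrt (2 * pi * (2 * (l\<^sup>2 * u))) = 2 * sqrt pi * \<bar>l\<bar> * sqrt u" .
      moreover have "- (l - 0)\<^sup>2 / (2 * (2 * (l\<^sup>2 * u))) = - 1 / (4 * u)"
        using assms True by (simp add: field_simps)
      ultimately show ?thesis
        using True by (simp add: normal_density_def)
    qed
    have 3: "\<bar>l\<bar> powr (\<kappa> - 2) * l\<^sup>2 / \<bar>l\<bar> = \<bar>l\<bar> powr (\<kappa> - 1)"
    proof -
      have "\<bar>l\<bar> powr (\<kappa> - 1) = \<bar>l\<bar> powr (\<kappa> - 2) * \<bar>l\<bar> powr 1"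
        unfolding powr_add[symmetric] by simp
      moreover have "l\<^sup>2 / \<bar>l\<bar> = \<bar>l\<bar>"
        using assms by (auto simp: power2_eq_square abs_if)
      ultimately show ?thesis
        by (simp add: times_divide_eq_right[symmetric] del: times_divide_eq_right)
    qed
    have 4: "u powr (\<kappa> / 2 - 1) / sqrt u = u powr ((\<kappa> - 1) / 2 - 1)"
      using True by (simp add: powr_half_sqrt[symmetric] powr_diff[symmetric] diff_divide_distrib)
    have 5: "l\<^sup>2 * u > 0" using l2 True by simp
    have "gamma_normal \<kappa> (0 + l\<^sup>2 * u, l) * l\<^sup>2
        = (\<bar>l\<bar> powr (\<kappa> - 2) * l\<^sup>2 / \<bar>l\<bar>) / (2 * sqrt pi) * ((u powr (\<kappa> / 2 - 1) / sqrt u) * exp (- 1 / (4 * u)) * exp (- (l\<^sup>2 * u)))"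
      using 5 unfolding gamma_normal_def by (simp add: 1 2, simp only: mult_ac)
    then show ?thesis
      unfolding 3 4 using True by simp
  next
    case False
    then have "\<not> l\<^sup>2 * u > 0" using l2 by (simp add: zero_less_mult_iff)
    then show ?thesis using False by (simp add: gamma_normal_def)
  qed
  have "(\<integral>s. gamma_normal \<kappa> (s, l) \<partial>lborel) = \<bar>l\<^sup>2\<bar> *\<^sub>R (\<integral>u. gamma_normal \<kappa> (0 + l\<^sup>2 * u, l) \<partial>lborel)"
    using l2 by (intro lborel_integral_real_affine) auto
  also have "\<dots> = (\<integral>u. gamma_normal \<kappa> (0 + l\<^sup>2 * u, l) * l\<^sup>2 \<partial>lborel)"
    by simp
  also have "\<dots> = \<bar>l\<bar> powr (\<kappa> - 1) / (2 * sqrt pi) * (\<integral>u. ?F u * exp (- (l\<^sup>2 * u)) \<partial>lborel)"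
    unfolding eq by (rule integral_mult_right_zero)
  finally show ?thesis
    by (simp add: bessel_density_def bessel_factor_def)
qed

lemma bessel_density_le: "l \<noteq> 0 \<Longrightarrow> bessel_density \<kappa> l \<le> c2 \<kappa> * \<bar>l\<bar> powr (\<kappa> - 1)"
  using bessel_factor_le[of l] by (simp add: bessel_density_eq mult.commute mult_left_mono)

end

text \<open>Both functions are probability densities, the mass of \<open>g\<close> being read off at
  \<open>x = 0\<close>. Levy's theorem identifies the measures and uniqueness of densities the
  functions, though only almost everywhere, which is all that a Fourier transform
  determines.\<close>

lemma fourier_density_unique:
  fixes f g :: "real \<Rightarrow> real"
  assumes f: "integrable lborel f" "\<And>l. f l \<ge> 0" "integral\<^sup>L lborel f = 1"
    and g: "integrable lborel g" "\<And>l. g l \<ge> 0"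
    and eq: "\<And>x. (\<integral>l. f l *\<^sub>R cis (x * l) \<partial>lborel) = (\<integral>l. g l *\<^sub>R cis (x * l) \<partial>lborel)"
  shows "AE l in lborel. f l = g l"
proof -
  note [measurable] = borel_measurable_integrable[OF f(1)] borel_measurable_integrable[OF g(1)]
  have g1: "integral\<^sup>L lborel g = 1"
  proof -
    have "complex_of_real (integral\<^sup>L lborel f) = complex_of_real (integral\<^sup>L lborel g)"
      using eq[of 0] by (simp add: scaleR_conv_of_real)
    then show ?thesis using f(3) by simp
  qed
  have rd: "real_distribution (density lborel h)"
    if h: "integrable lborel h" "\<And>l. h l \<ge> 0" "integral\<^sup>L lborel h = 1" for h :: "real \<Rightarrow> real"
  proof -
    note [measurable] = borel_measurable_integrable[OF h(1)]
    have "(\<integral>\<^sup>+l. ennreal (h l) \<partial>lborel) = 1"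
      using h by (simp add: nn_integral_eq_integral)
    then have "prob_space (density lborel h)"
      by (intro prob_spaceI) (simp add: emeasure_density)
    then show ?thesis
      by (simp add: real_distribution_def real_distribution_axioms_def)
  qed
  have ch: "char (density lborel h) x = (\<integral>l. h l *\<^sub>R cis (x * l) \<partial>lborel)"
    if h: "h \<in> borel_measurable lborel" "\<And>l. h l \<ge> 0" for h :: "real \<Rightarrow> real" and x
    unfolding char_def using h by (subst integral_density) (auto simp: cis_conv_exp)
  have "char (density lborel f) = char (density lborel g)"
    using eq f(2) g(2) by (auto simp: ch)
  then have "density lborel f = density lborel g"
    using rd[OF f] rd[OF g g1] by (intro Levy_uniqueness) auto
  then have "AE l in lborel. ennreal (f l) = ennreal (g l)"
    by (subst (asm) sigma_finite_measure.density_unique_iff[OF sigma_finite_lborel]) auto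
  then show ?thesis
    by eventually_elim (use f(2) g(2) in simp)
qed

lemma integrable_bessel_shift:
  assumes "0 < \<kappa>" "\<kappa> < 1"
  shows "integrable lborel (\<lambda>l. bessel_density \<kappa> (l + w))"
  using lborel_integrable_real_affine[OF integrable_bessel_density[OF assms], of 1 w] by (simp add: add.commute)

lemma integrable_scaleR_cis:
  fixes f :: "real \<Rightarrow> real"
  assumes "integrable lborel f"
  shows "integrable lborel (\<lambda>l. f l *\<^sub>R cis (x * l))"
proof (rule Bochner_Integration.integrable_bound[OF assms])
  show "(\<lambda>l. f l *\<^sub>R cis (x * l)) \<in> borel_measurable lborel"
    using borel_measurable_integrable[OF assms] by simp
qed simp

text \<open>Translation becomes a phase; the phases for \<open>w\<close> and \<open>- w\<close> add
  up to twice the cosine in the covariance.\<close>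

lemma bessel_shift_fourier:
  assumes "0 < \<kappa>" "\<kappa> < 1"
  shows "(\<integral>l. bessel_density \<kappa> (l + w) *\<^sub>R cis (x * l) \<partial>lborel) = cis (- (w * x)) * of_real (1 / (1 + x\<^sup>2) powr (\<kappa> / 2))"
proof -
  have "(\<integral>l. bessel_density \<kappa> (l + w) *\<^sub>R cis (x * l) \<partial>lborel)
      = \<bar>1\<bar> *\<^sub>R (\<integral>y. bessel_density \<kappa> (- w + 1 * y + w) *\<^sub>R cis (x * (- w + 1 * y)) \<partial>lborel)"
    by (rule lborel_integral_real_affine) simp
  also have "\<dots> = (\<integral>y. cis (- (w * x)) * (bessel_density \<kappa> y *\<^sub>R cis (x * y)) \<partial>lborel)"
    by (simp add: ring_distribs cis_mult mult.commute[of w])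
  also have "\<dots> = cis (- (w * x)) * (\<integral>y. bessel_density \<kappa> y *\<^sub>R cis (x * y) \<partial>lborel)"
    by (rule integral_mult_right_zero)
  finally show ?thesis
    by (simp only: bessel_density_fourier[OF assms])
qed

text \<open>The explicit version of \<open>f\<close>. When \<open>w 0 = 0\<close> the two halves for
  \<open>j = 0\<close> coincide. Writing \<open>l + - w j\<close> makes both shifts instances of
  statements about \<open>l + v\<close>.\<close>

definition spectral_density :: "nat \<Rightarrow> (nat \<Rightarrow> real) \<Rightarrow> (nat \<Rightarrow> real) \<Rightarrow> (nat \<Rightarrow> real) \<Rightarrow> real \<Rightarrow> real" where
  "spectral_density n A w \<kappa> l =
     (\<Sum>j=0..n. A j / 2 * (bessel_density (\<kappa> j) (l + w j) + bessel_density (\<kappa> j) (l + - w j)))"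

text \<open>Where the shifted density is large, i.e. near \<open>- w\<close>, the rescaled function is already
  of order \<open>\<delta>\<close>; elsewhere the density is bounded and the rescaled function has mass of order \<open>\<delta>\<close>.\<close>
lemma bessel_scaling_shift:
  fixes \<Phi> :: "real \<Rightarrow> real" and \<delta> :: "nat \<Rightarrow> real"
  assumes \<kappa>: "0 < \<kappa>" "\<kappa> < 1" and \<kappa>0: "\<kappa>0 < 1" and w: "w \<noteq> 0"
    and \<Phi>: "integrable lborel \<Phi>" "\<And>l. 0 \<le> \<Phi> l" "\<And>l. \<Phi> l * \<bar>l\<bar> \<le> K"
    and \<delta>: "\<And>i. \<delta> i > 0" "\<delta> \<longlonglongrightarrow> 0"
  shows "(\<lambda>i. \<delta> i powr (- \<kappa>0) * (\<integral>l. \<Phi> (l / \<delta> i) * bessel_density \<kappa> (l + w) \<partial>lborel)) \<longlonglongrightarrow> 0"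
proof -
  \<comment> \<open>\<open>B\<close> is the largest value of
    \<open>c2 \<kappa> * \<bar>l + w\<bar> powr (\<kappa> - 1)\<close> on the region where
    \<open>\<bar>l + w\<bar>\<close> is at least \<open>\<bar>w\<bar> / 2\<close>. The summands of
    \<open>C\<close> are the integrals of the two terms of the pointwise bound, each divided by
    \<open>d\<close>.\<close>
  define B where "B = c2 \<kappa> * (\<bar>w\<bar> / 2) powr (\<kappa> - 1)"
  define C where "C = B * integral\<^sup>L lborel \<Phi> + 2 * K / \<bar>w\<bar> * integral\<^sup>L lborel (\<lambda>l. bessel_density \<kappa> (l + w))"
  have B0: "B \<ge> 0" using c2_nonneg[OF \<kappa>] by (simp add: B_def)
  have bound: "\<Phi> (l / d) * bessel_density \<kappa> (l + w) \<le> B * \<Phi> (l / d) + 2 * K / \<bar>w\<bar> * d * bessel_density \<kappa> (l + w)"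
    if d: "d > 0" for l d
  proof (cases "\<bar>l + w\<bar> \<ge> \<bar>w\<bar> / 2")
    case True
    then have nz: "l + w \<noteq> 0" using w by auto
    have "bessel_density \<kappa> (l + w) \<le> c2 \<kappa> * \<bar>l + w\<bar> powr (\<kappa> - 1)"
      by (rule bessel_density_le[OF \<kappa> nz])
    also have "\<dots> \<le> B"
      unfolding B_def using True w \<kappa> c2_nonneg[OF \<kappa>]
      by (intro mult_left_mono powr_mono2') auto
    finally have "\<Phi> (l / d) * bessel_density \<kappa> (l + w) \<le> \<Phi> (l / d) * B"
      using \<Phi>(2) by (intro mult_left_mono)
    moreover have "0 \<le> K" using \<Phi>(3)[of 0] by simp
    ultimately show ?thesis
      using d bessel_density_nonneg[OF \<kappa>, of "l + w"]
      by (simp add: mult.commute add_increasing2)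
  next
    case False
    then have l: "\<bar>l\<bar> \<ge> \<bar>w\<bar> / 2" by linarith
    then have "\<bar>w\<bar> / 2 / d \<le> \<bar>l / d\<bar>"
      unfolding abs_divide abs_of_pos[OF d] using d by (intro divide_right_mono) auto
    then have "\<Phi> (l / d) * (\<bar>w\<bar> / 2 / d) \<le> \<Phi> (l / d) * \<bar>l / d\<bar>"
      using \<Phi>(2) by (rule mult_left_mono)
    also have "\<dots> \<le> K" by (rule \<Phi>(3))
    finally have "\<Phi> (l / d) \<le> 2 * K / \<bar>w\<bar> * d"
      using d w by (simp add: field_simps)
    then have "\<Phi> (l / d) * bessel_density \<kappa> (l + w) \<le> 2 * K / \<bar>w\<bar> * d * bessel_density \<kappa> (l + w)"
      using bessel_density_nonneg[OF \<kappa>] by (intro mult_right_mono)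
    moreover have "0 \<le> B * \<Phi> (l / d)" using B0 \<Phi>(2) by simp
    ultimately show ?thesis by linarith
  qed
  have est: "0 \<le> (\<integral>l. \<Phi> (l / d) * bessel_density \<kappa> (l + w) \<partial>lborel)"
      "(\<integral>l. \<Phi> (l / d) * bessel_density \<kappa> (l + w) \<partial>lborel) \<le> C * d" if d: "d > 0" for d
  proof -
    note [measurable] = borel_measurable_integrable[OF \<Phi>(1)] borel_measurable_integrable[OF integrable_bessel_density[OF \<kappa>]]
    have nn: "0 \<le> \<Phi> (l / d) * bessel_density \<kappa> (l + w)" for l
      using \<Phi>(2) bessel_density_nonneg[OF \<kappa>] by simp
    then show "0 \<le> (\<integral>l. \<Phi> (l / d) * bessel_density \<kappa> (l + w) \<partial>lborel)"
      by (rule Bochner_Integration.integral_nonneg)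
    have i1: "integrable lborel (\<lambda>l. \<Phi> (l / d))"
      using lborel_integrable_real_affine[OF \<Phi>(1), of "1 / d" 0] d by simp
    have i2: "integrable lborel (\<lambda>l. B * \<Phi> (l / d) + 2 * K / \<bar>w\<bar> * d * bessel_density \<kappa> (l + w))"
      using i1 integrable_bessel_shift[OF \<kappa>] by simp
    have "integrable lborel (\<lambda>l. \<Phi> (l / d) * bessel_density \<kappa> (l + w))"
    proof (rule Bochner_Integration.integrable_bound[OF i2])
      show "AE l in lborel. norm (\<Phi> (l / d) * bessel_density \<kappa> (l + w))
          \<le> norm (B * \<Phi> (l / d) + 2 * K / \<bar>w\<bar> * d * bessel_density \<kappa> (l + w))"
        unfolding real_norm_def
      proof (intro always_eventually allI)
        fix l show "\<bar>\<Phi> (l / d) * bessel_density \<kappa> (l + w)\<bar>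
          \<le> \<bar>B * \<Phi> (l / d) + 2 * K / \<bar>w\<bar> * d * bessel_density \<kappa> (l + w)\<bar>"
          using bound[OF d, of l] nn[of l] by linarith
      qed
    qed measurable
    then have "(\<integral>l. \<Phi> (l / d) * bessel_density \<kappa> (l + w) \<partial>lborel)
        \<le> (\<integral>l. B * \<Phi> (l / d) + 2 * K / \<bar>w\<bar> * d * bessel_density \<kappa> (l + w) \<partial>lborel)"
      using i2 bound[OF d] by (rule integral_mono)
    also have "\<dots> = B * (\<integral>l. \<Phi> (l / d) \<partial>lborel) + 2 * K / \<bar>w\<bar> * d * (\<integral>l. bessel_density \<kappa> (l + w) \<partial>lborel)"
      using i1 integrable_bessel_shift[OF \<kappa>] by simp
    also have "(\<integral>l. \<Phi> (l / d) \<partial>lborel) = d * integral\<^sup>L lborel \<Phi>"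
      using lborel_integral_real_affine[of d "\<lambda>l. \<Phi> (l / d)" 0] d by simp
    finally show "(\<integral>l. \<Phi> (l / d) * bessel_density \<kappa> (l + w) \<partial>lborel) \<le> C * d"
      by (simp add: C_def algebra_simps)
  qed
  \<comment> \<open>The normalisation costs a power \<open>- \<kappa>0\<close> against an integral
    of order 1 in \<open>\<delta> i\<close>; the product vanishes since
    \<open>\<kappa>0 < 1\<close>, whatever \<open>\<kappa>\<close> is.\<close>
  have "(\<lambda>i. \<delta> i powr (1 - \<kappa>0)) \<longlonglongrightarrow> 0 powr (1 - \<kappa>0)"
    using \<delta> \<kappa>0 less_imp_le[OF \<delta>(1)] by (intro tendsto_powr') auto
  then have lim: "(\<lambda>i. C * \<delta> i powr (1 - \<kappa>0)) \<longlonglongrightarrow> 0"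
    using tendsto_mult_left[of _ 0 _ C] by simp
  show ?thesis
  proof (rule tendsto_sandwich[OF _ _ tendsto_const lim])
    show "\<forall>\<^sub>F i in sequentially. 0 \<le> \<delta> i powr (- \<kappa>0) * (\<integral>l. \<Phi> (l / \<delta> i) * bessel_density \<kappa> (l + w) \<partial>lborel)"
      using est(1) \<delta>(1) by simp
    have "\<delta> i powr (- \<kappa>0) * (\<integral>l. \<Phi> (l / \<delta> i) * bessel_density \<kappa> (l + w) \<partial>lborel) \<le> \<delta> i powr (- \<kappa>0) * (C * \<delta> i)" for i
      using est(2)[OF \<delta>(1)] by (intro mult_left_mono) auto
    moreover have "\<delta> i powr (- \<kappa>0) * (C * \<delta> i) = C * \<delta> i powr (1 - \<kappa>0)" for i
      using \<delta>(1)[of i] by (simp add: powr_diff powr_minus divide_inverse)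
    ultimately show "\<forall>\<^sub>F i in sequentially. \<delta> i powr (- \<kappa>0) * (\<integral>l. \<Phi> (l / \<delta> i) * bessel_density \<kappa> (l + w) \<partial>lborel) \<le> C * \<delta> i powr (1 - \<kappa>0)"
      by simp
  qed
qed

text \<open>After rescaling \<open>l\<close> the powers of \<open>\<delta> i\<close> cancel exactly:
  \<open>- \<kappa>\<close> from the normalisation, 1 from the substitution and
  \<open>\<kappa> - 1\<close> from the homogeneous singularity. Only the argument of
  \<open>bessel_factor\<close> still depends on \<open>i\<close>.\<close>

lemma bessel_scaling_origin:
  fixes \<Phi> :: "real \<Rightarrow> real" and \<delta> :: "nat \<Rightarrow> real"
  assumes \<kappa>: "0 < \<kappa>" "\<kappa> < 1"
    and \<Phi>: "\<Phi> \<in> borel_measurable borel" "integrable lborel (\<lambda>l. \<Phi> l * \<bar>l\<bar> powr (\<kappa> - 1))" "\<And>l. 0 \<le> \<Phi> l"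
    and \<delta>: "\<And>i. \<delta> i > 0" "\<delta> \<longlonglongrightarrow> 0"
  shows "(\<lambda>i. \<delta> i powr (- \<kappa>) * (\<integral>l. \<Phi> (l / \<delta> i) * bessel_density \<kappa> l \<partial>lborel))
    \<longlonglongrightarrow> c2 \<kappa> * (\<integral>l. \<Phi> l * \<bar>l\<bar> powr (\<kappa> - 1) \<partial>lborel)"
proof -
  note [measurable] = \<Phi>(1) borel_measurable_integrable[OF integrable_bessel_density[OF \<kappa>]]
  let ?G = "\<lambda>i l. \<delta> i powr (1 - \<kappa>) * (\<Phi> l * bessel_density \<kappa> (\<delta> i * l))"
  have G_eq: "?G i l = \<Phi> l * \<bar>l\<bar> powr (\<kappa> - 1) * bessel_factor \<kappa> (\<delta> i * l)" if "l \<noteq> 0" for i l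
  proof -
    have "\<delta> i powr (1 - \<kappa>) * \<bar>\<delta> i * l\<bar> powr (\<kappa> - 1) = (\<delta> i powr (1 - \<kappa>) * \<delta> i powr (\<kappa> - 1)) * \<bar>l\<bar> powr (\<kappa> - 1)"
      using \<delta>(1)[of i] by (simp add: abs_mult powr_mult)
    also have "\<delta> i powr (1 - \<kappa>) * \<delta> i powr (\<kappa> - 1) = 1"
      unfolding powr_add[symmetric] using \<delta>(1)[of i] by simp
    finally have "\<delta> i powr (1 - \<kappa>) * \<bar>\<delta> i * l\<bar> powr (\<kappa> - 1) = \<bar>l\<bar> powr (\<kappa> - 1)" by simp
    moreover have "bessel_density \<kappa> (\<delta> i * l) = \<bar>\<delta> i * l\<bar> powr (\<kappa> - 1) * bessel_factor \<kappa> (\<delta> i * l)"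
      using \<delta>(1)[of i] that by (intro bessel_density_eq[OF \<kappa>]) auto
    ultimately show ?thesis by (metis mult.assoc mult.left_commute)
  qed
  have nz: "AE l in lborel. l \<noteq> (0::real)" by (rule AE_lborel_singleton)
  have "(\<lambda>i. integral\<^sup>L lborel (?G i)) \<longlonglongrightarrow> (\<integral>l. \<Phi> l * \<bar>l\<bar> powr (\<kappa> - 1) * c2 \<kappa> \<partial>lborel)"
  proof (rule integral_dominated_convergence)
    show "integrable lborel (\<lambda>l. \<Phi> l * \<bar>l\<bar> powr (\<kappa> - 1) * c2 \<kappa>)"
      using \<Phi>(2) by simp
    show "AE l in lborel. (\<lambda>i. ?G i l) \<longlonglongrightarrow> \<Phi> l * \<bar>l\<bar> powr (\<kappa> - 1) * c2 \<kappa>"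
      using nz
    proof eventually_elim
      case (elim l)
      have "(\<lambda>i. \<delta> i * l) \<longlonglongrightarrow> 0 * l" by (intro tendsto_intros \<delta>)
      then have "(\<lambda>i. bessel_factor \<kappa> (\<delta> i * l)) \<longlonglongrightarrow> c2 \<kappa>"
        by (intro bessel_factor_tendsto[OF \<kappa>]) simp
      then show ?case unfolding G_eq[OF elim] by (rule tendsto_mult_left)
    qed
    show "AE l in lborel. norm (?G i l) \<le> \<Phi> l * \<bar>l\<bar> powr (\<kappa> - 1) * c2 \<kappa>" for i
      using nz
    proof eventually_elim
      case (elim l)
      show ?case unfolding G_eq[OF elim]
        using \<Phi>(3)[of l] bessel_factor_le[OF \<kappa>] bessel_factor_nonneg[OF \<kappa>]
        by (simp add: abs_mult mult_left_mono)
    qed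
  qed measurable
  moreover have "integral\<^sup>L lborel (?G i) = \<delta> i powr (- \<kappa>) * (\<integral>l. \<Phi> (l / \<delta> i) * bessel_density \<kappa> l \<partial>lborel)" for i
  proof -
    have "(\<integral>l. \<Phi> (l / \<delta> i) * bessel_density \<kappa> l \<partial>lborel)
        = \<delta> i * (\<integral>l. \<Phi> l * bessel_density \<kappa> (\<delta> i * l) \<partial>lborel)"
      using lborel_integral_real_affine[of "\<delta> i" "\<lambda>l. \<Phi> (l / \<delta> i) * bessel_density \<kappa> l" 0] \<delta>(1)[of i] by simp
    moreover have "\<delta> i powr (1 - \<kappa>) = \<delta> i powr (- \<kappa>) * \<delta> i"
      using \<delta>(1)[of i] by (simp add: powr_diff powr_minus divide_inverse)
    ultimately show ?thesis by simp
  qed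
  ultimately show ?thesis by (simp add: mult.commute)
qed

section \<open>Superposition of the shifted densities\<close>

context
  fixes n :: nat and A w \<kappa> :: "nat \<Rightarrow> real"
  assumes A_nonneg: "\<And>j. j \<le> n \<Longrightarrow> A j \<ge> 0"
    and \<kappa>_range: "\<And>j. j \<le> n \<Longrightarrow> 0 < \<kappa> j" "\<And>j. j \<le> n \<Longrightarrow> \<kappa> j < 1"
begin

lemma spectral_density_nonneg: "spectral_density n A w \<kappa> l \<ge> 0"
  unfolding spectral_density_def
  by (intro sum_nonneg mult_nonneg_nonneg add_nonneg_nonneg bessel_density_nonneg)
    (auto simp: A_nonneg \<kappa>_range)

lemma spectral_density_even: "spectral_density n A w \<kappa> (- l) = spectral_density n A w \<kappa> l"
  unfolding spectral_density_def
proof (intro sum.cong refl)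
  fix j assume "j \<in> {0..n}"
  then have "bessel_density (\<kappa> j) (- l + w j) = bessel_density (\<kappa> j) (l + - w j)"
    "bessel_density (\<kappa> j) (- l + - w j) = bessel_density (\<kappa> j) (l + w j)"
    using bessel_density_even[of "\<kappa> j" "l + - w j"] bessel_density_even[of "\<kappa> j" "l + w j"] \<kappa>_range
    by (simp_all add: add.commute)
  then show "A j / 2 * (bessel_density (\<kappa> j) (- l + w j) + bessel_density (\<kappa> j) (- l + - w j))
    = A j / 2 * (bessel_density (\<kappa> j) (l + w j) + bessel_density (\<kappa> j) (l + - w j))"
    by simp
qed

lemma integrable_spectral_density: "integrable lborel (spectral_density n A w \<kappa>)"
  unfolding spectral_density_def[abs_def]
  by (intro Bochner_Integration.integrable_sum integrable_mult_right Bochner_Integration.integrable_add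
      integrable_bessel_shift) (auto simp: \<kappa>_range)

lemma spectral_density_fourier:
  "(\<integral>l. spectral_density n A w \<kappa> l *\<^sub>R cis (x * l) \<partial>lborel) = of_real (cov_B n A w \<kappa> x)"
proof -
  have i: "integrable lborel (\<lambda>l. bessel_density (\<kappa> j) (l + v) *\<^sub>R cis (x * l))" if "j \<in> {0..n}" for j v
    using that by (intro integrable_scaleR_cis integrable_bessel_shift) (auto simp: \<kappa>_range)
  have "(\<integral>l. spectral_density n A w \<kappa> l *\<^sub>R cis (x * l) \<partial>lborel)
      = (\<integral>l. (\<Sum>j=0..n. (A j / 2) *\<^sub>R (bessel_density (\<kappa> j) (l + w j) *\<^sub>R cis (x * l) + bessel_density (\<kappa> j) (l + - w j) *\<^sub>R cis (x * l))) \<partial>lborel)"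
    by (simp add: spectral_density_def scaleR_sum_left scaleR_add_left scaleR_add_right distrib_left)
  also have "\<dots> = (\<Sum>j=0..n. (A j / 2) *\<^sub>R ((\<integral>l. bessel_density (\<kappa> j) (l + w j) *\<^sub>R cis (x * l) \<partial>lborel) + (\<integral>l. bessel_density (\<kappa> j) (l + - w j) *\<^sub>R cis (x * l) \<partial>lborel)))"
    by (subst Bochner_Integration.integral_sum)
      (auto intro!: sum.cong integrable_scaleR_right Bochner_Integration.integrable_add i
        simp del: scaleR_add_right add_uminus_conv_diff simp: Bochner_Integration.integral_add[OF i i])
  also have "\<dots> = (\<Sum>j=0..n. of_real (A j * cos (w j * x) / (1 + x\<^sup>2) powr (\<kappa> j / 2)))"
  proof (intro sum.cong refl)
    fix j assume "j \<in> {0..n}"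
    then have r: "0 < \<kappa> j" "\<kappa> j < 1" by (auto simp: \<kappa>_range)
    show "(A j / 2) *\<^sub>R ((\<integral>l. bessel_density (\<kappa> j) (l + w j) *\<^sub>R cis (x * l) \<partial>lborel) + (\<integral>l. bessel_density (\<kappa> j) (l + - w j) *\<^sub>R cis (x * l) \<partial>lborel))
      = of_real (A j * cos (w j * x) / (1 + x\<^sup>2) powr (\<kappa> j / 2))"
      unfolding bessel_shift_fourier[OF r] by (simp add: complex_eq_iff)
  qed
  finally show ?thesis by (simp add: cov_B_def)
qed

text \<open>The bound \<open>B\<close> makes each product with a shifted density integrable, so that
  the sum can be split. Integrability of \<open>\<Phi>\<close> and the bound \<open>K\<close> serve
  the terms with \<open>j > 0\<close>; integrability against the singular weight serves
  \<open>j = 0\<close>, the only term that survives.\<close>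

lemma spectral_scaling:
  fixes \<Phi> :: "real \<Rightarrow> real" and \<delta> :: "nat \<Rightarrow> real"
  assumes w0: "w 0 = 0" and w: "\<And>j. 1 \<le> j \<Longrightarrow> j \<le> n \<Longrightarrow> w j \<noteq> 0"
    and \<Phi>: "integrable lborel \<Phi>" "integrable lborel (\<lambda>l. \<Phi> l * \<bar>l\<bar> powr (\<kappa> 0 - 1))"
      "\<And>l. 0 \<le> \<Phi> l" "\<And>l. \<Phi> l \<le> B" "\<And>l. \<Phi> l * \<bar>l\<bar> \<le> K"
    and \<delta>: "\<And>i. \<delta> i > 0" "\<delta> \<longlonglongrightarrow> 0"
  shows "(\<lambda>i. \<delta> i powr (- \<kappa> 0) * (\<integral>l. \<Phi> (l / \<delta> i) * spectral_density n A w \<kappa> l \<partial>lborel))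
    \<longlonglongrightarrow> A 0 * c2 (\<kappa> 0) * (\<integral>l. \<Phi> l * \<bar>l\<bar> powr (\<kappa> 0 - 1) \<partial>lborel)"
proof -
  note [measurable] = borel_measurable_integrable[OF \<Phi>(1)]
  let ?J = "\<lambda>j v i. \<delta> i powr (- \<kappa> 0) * (\<integral>l. \<Phi> (l / \<delta> i) * bessel_density (\<kappa> j) (l + v) \<partial>lborel)"
  let ?L = "\<integral>l. \<Phi> l * \<bar>l\<bar> powr (\<kappa> 0 - 1) \<partial>lborel"
  have int: "integrable lborel (\<lambda>l. \<Phi> (l / d) * bessel_density (\<kappa> j) (l + v))" if "j \<in> {0..n}" for j v d
  proof (rule Bochner_Integration.integrable_bound)
    have r: "0 < \<kappa> j" "\<kappa> j < 1" using that by (auto simp: \<kappa>_range)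
    note [measurable] = borel_measurable_integrable[OF integrable_bessel_shift[OF r]]
    show "integrable lborel (\<lambda>l. B * bessel_density (\<kappa> j) (l + v))"
      using integrable_bessel_shift[OF r] by simp
    show "(\<lambda>l. \<Phi> (l / d) * bessel_density (\<kappa> j) (l + v)) \<in> borel_measurable lborel" by measurable
    show "AE l in lborel. norm (\<Phi> (l / d) * bessel_density (\<kappa> j) (l + v)) \<le> norm (B * bessel_density (\<kappa> j) (l + v))"
      using \<Phi>(3,4) bessel_density_nonneg[OF r] order_trans[OF \<Phi>(3,4)]
      by (intro always_eventually allI) (simp add: abs_mult mult_right_mono)
  qed
  have eq: "\<delta> i powr (- \<kappa> 0) * (\<integral>l. \<Phi> (l / \<delta> i) * spectral_density n A w \<kappa> l \<partial>lborel)
      = (\<Sum>j=0..n. A j / 2 * (?J j (w j) i + ?J j (- w j) i))" for i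
  proof -
    have "(\<integral>l. \<Phi> (l / \<delta> i) * spectral_density n A w \<kappa> l \<partial>lborel)
        = (\<integral>l. (\<Sum>j=0..n. A j / 2 * (\<Phi> (l / \<delta> i) * bessel_density (\<kappa> j) (l + w j) + \<Phi> (l / \<delta> i) * bessel_density (\<kappa> j) (l + - w j))) \<partial>lborel)"
      by (simp add: spectral_density_def sum_distrib_left distrib_left mult_ac)
    also have "\<dots> = (\<Sum>j=0..n. A j / 2 * ((\<integral>l. \<Phi> (l / \<delta> i) * bessel_density (\<kappa> j) (l + w j) \<partial>lborel) + (\<integral>l. \<Phi> (l / \<delta> i) * bessel_density (\<kappa> j) (l + - w j) \<partial>lborel)))"
      by (subst Bochner_Integration.integral_sum)
        (auto intro!: sum.cong integrable_mult_right Bochner_Integration.integrable_add int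
          simp del: add_uminus_conv_diff simp: Bochner_Integration.integral_add[OF int int])
    finally show ?thesis by (simp add: sum_distrib_left distrib_left mult_ac)
  qed
  have lim: "(\<lambda>i. A j / 2 * (?J j (w j) i + ?J j (- w j) i)) \<longlonglongrightarrow> (if j = 0 then A 0 * c2 (\<kappa> 0) * ?L else 0)"
    if j: "j \<in> {0..n}" for j
  proof (cases "j = 0")
    case True
    have "(\<lambda>i. ?J 0 0 i) \<longlonglongrightarrow> c2 (\<kappa> 0) * ?L"
      using bessel_scaling_origin[of "\<kappa> 0" \<Phi> \<delta>] \<Phi> \<delta> \<kappa>_range by simp
    then have "(\<lambda>i. A 0 / 2 * (?J 0 0 i + ?J 0 0 i)) \<longlonglongrightarrow> A 0 / 2 * (c2 (\<kappa> 0) * ?L + c2 (\<kappa> 0) * ?L)"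
      by (intro tendsto_mult_left tendsto_add)
    then show ?thesis using True w0 by (simp add: mult.assoc)
  next
    case False
    have 0: "(\<lambda>i. ?J j v i) \<longlonglongrightarrow> 0" if "v \<noteq> 0" for v
      using j that \<Phi> \<delta> \<kappa>_range by (intro bessel_scaling_shift) auto
    have "w j \<noteq> 0" "- w j \<noteq> 0"
      using j False w[of j] by auto
    then have "(\<lambda>i. A j / 2 * (?J j (w j) i + ?J j (- w j) i)) \<longlonglongrightarrow> A j / 2 * (0 + 0)"
      by (intro tendsto_mult_left tendsto_add 0)
    then show ?thesis using False by simp
  qed
  have "(\<lambda>i. \<Sum>j=0..n. A j / 2 * (?J j (w j) i + ?J j (- w j) i))
      \<longlonglongrightarrow> (\<Sum>j=0..n. if j = 0 then A 0 * c2 (\<kappa> 0) * ?L else 0)"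
    by (rule tendsto_sum) (rule lim)
  then show ?thesis unfolding eq by simp
qed

end

section \<open>The covariance of the limit field\<close>

lemma abs_moment_integral:
  fixes s \<tau> :: real
  assumes s: "s > 0" and \<tau>: "\<tau> > 0" and m: "m > 0" "even m"
  shows "has_bochner_integral lborel (\<lambda>l. \<bar>l\<bar> powr (s - 1) * exp (- \<tau> * l ^ m))
    (2 * Gamma (s / real m) * \<tau> powr (- (s / real m)) / real m)"
proof -
  let ?F = "\<lambda>x::real. indicator {0<..} x * (x powr (s - 1) * exp (- \<tau> * x ^ m))"
  let ?G = "Gamma (s / real m) * \<tau> powr (- (s / real m)) / real m"
  have 1: "has_bochner_integral lborel ?F ?G"
    by (rule Gamma_integral_power[OF s \<tau> m(1)])
  have 2: "has_bochner_integral lborel (\<lambda>x. ?F (0 + (-1) * x)) (?G /\<^sub>R \<bar>-1\<bar>)"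
    using 1 by (subst (asm) lborel_has_bochner_integral_real_affine_iff[of "-1" _ _ 0]) simp
  \<comment> \<open>At \<open>l = 0\<close> both sides are 0, since \<open>powr\<close> with base 0
    is 0 for every exponent, including the exponent 0 that occurs for \<open>s = 1\<close>.\<close>
  have "?F l + ?F (0 + (-1) * l) = \<bar>l\<bar> powr (s - 1) * exp (- \<tau> * l ^ m)" for l
    using m(2) by (cases "l = 0"; cases "l > 0") auto
  then show ?thesis
    using has_bochner_integral_add[OF 1 2] by (simp add: mult.assoc)
qed

text \<open>Used to replace the exponent \<open>m\<close> by 2, so that one Gaussian majorant
  dominates the cosine series for every even \<open>m\<close>.\<close>

lemma square_le_even_power: "(l::real)\<^sup>2 - 1 \<le> l ^ m" if "m > 0" "even m"
proof (cases "\<bar>l\<bar> \<ge> 1")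
  case True
  have "l\<^sup>2 = \<bar>l\<bar> ^ 2" by simp
  also have "\<dots> \<le> \<bar>l\<bar> ^ m"
    using True that by (intro power_increasing) (auto elim: evenE)
  also have "\<dots> = l ^ m" using that by (simp add: power_even_abs)
  finally show ?thesis by simp
next
  case False
  then have "l\<^sup>2 \<le> 1" by (simp add: abs_square_le_1)
  moreover have "0 \<le> l ^ m" using that by (simp add: zero_le_even_power)
  ultimately show ?thesis by linarith
qed

lemma even_exp_partial_sum_le:
  fixes x :: real
  shows "(\<Sum>k<N. \<bar>x\<bar> ^ (2 * k) / fact (2 * k)) \<le> exp \<bar>x\<bar>"
proof -
  have "(\<Sum>k<N. \<bar>x\<bar> ^ (2 * k) / fact (2 * k)) = (\<Sum>k\<in>(\<lambda>k. 2 * k) ` {..<N}. \<bar>x\<bar> ^ k / fact k)"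
    by (subst sum.reindex) (auto simp: inj_on_def)
  also have "\<dots> \<le> (\<Sum>k<2 * N. \<bar>x\<bar> ^ k / fact k)"
    by (intro sum_mono2) auto
  also have "\<dots> \<le> (\<Sum>k. \<bar>x\<bar> ^ k / fact k)"
    using summable_exp[of "\<bar>x\<bar>"] by (intro sum_le_suminf) (auto simp: divide_inverse mult.commute)
  also have "\<dots> = exp \<bar>x\<bar>" by (simp add: exp_def divide_inverse mult.commute)
  finally show ?thesis .
qed

text \<open>Duplication at k + 1/2. It turns the factorial of \<open>2 * k\<close> in the cosine
  series into the Gamma factor and the factorial of the Fox-Wright series; the power of 4 goes into
  the argument.\<close>

lemma Gamma_half_fact: "Gamma (1/2 + real k) * fact k = sqrt pi * fact (2 * k) / 4 ^ k"
proof -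
  have "Gamma (real k + 1/2) * Gamma (real k + 1/2 + 1/2)
      = 2 powr (1 - 2 * (real k + 1/2)) * sqrt pi * Gamma (2 * (real k + 1/2))"
    by (rule Gamma_legendre_duplication_real) simp
  moreover have "Gamma (real k + 1/2 + 1/2) = fact k"
    using Gamma_fact[of k, where 'a = real] by (simp add: add.commute)
  moreover have "Gamma (2 * (real k + 1/2)) = fact (2 * k)"
    using Gamma_fact[of "2 * k", where 'a = real] by (simp add: add.commute distrib_left)
  moreover have "2 powr (1 - 2 * (real k + 1/2)) = 1 / 4 ^ k"
  proof -
    have "1 - 2 * (real k + 1/2) = - real (2 * k)" by simp
    then have "2 powr (1 - 2 * (real k + 1/2)) = 1 / 2 powr (real (2 * k))"
      by (simp only: powr_minus_divide)
    also have "2 powr (real (2 * k)) = (2::real) ^ (2 * k)" by (rule powr_realpow) simp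
    finally show ?thesis by (simp add: power_mult)
  qed
  ultimately show ?thesis by (simp add: add.commute)
qed

text \<open>The k-th cosine term raises the exponent from \<open>\<kappa>\<close> to
  \<open>\<kappa> + 2 * real k\<close>, which is again an absolute moment. Dominated convergence of
  the partial sums yields the value and the summability of the Fox-Wright series at once.\<close>

lemma cos_moment_integral:
  fixes \<kappa> \<tau> z :: real
  assumes \<kappa>: "\<kappa> > 0" and \<tau>: "\<tau> > 0" and m: "m > 0" "even m"
  shows "(\<integral>l. \<bar>l\<bar> powr (\<kappa> - 1) * cos (l * z) * exp (- \<tau> * l ^ m) \<partial>lborel)
    = 2 * sqrt pi / (real m * \<tau> powr (\<kappa> / real m))
      * fox_wright_1_1 (\<kappa> / real m) (2 / real m) (1/2) 1 (- z\<^sup>2 / (4 * \<tau> powr (2 / real m)))"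
proof -
  define J where "J = (\<integral>l. \<bar>l\<bar> powr (\<kappa> - 1) * cos (l * z) * exp (- \<tau> * l ^ m) \<partial>lborel)"
  define c where "c = 2 * sqrt pi / (real m * \<tau> powr (\<kappa> / real m))"
  define y where "y = - z\<^sup>2 / (4 * \<tau> powr (2 / real m))"
  define q where "q k = (- 1) ^ k / fact (2 * k) * z ^ (2 * k)" for k :: nat
  define T where "T k l = \<bar>l\<bar> powr (\<kappa> - 1) * exp (- \<tau> * l ^ m) * ((- 1) ^ k / fact (2 * k) * (l * z) ^ (2 * k))" for k l
  define Ik where "Ik k = q k * (2 * Gamma ((\<kappa> + 2 * real k) / real m) * \<tau> powr (- ((\<kappa> + 2 * real k) / real m)) / real m)" for k
  have hb: "has_bochner_integral lborel (T k) (Ik k)" for k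
  proof -
    have "has_bochner_integral lborel (\<lambda>l. q k * (\<bar>l\<bar> powr (\<kappa> + 2 * real k - 1) * exp (- \<tau> * l ^ m))) (Ik k)"
      unfolding Ik_def using \<kappa> \<tau> m
      by (intro has_bochner_integral_mult_right abs_moment_integral) auto
    moreover have "q k * (\<bar>l\<bar> powr (\<kappa> + 2 * real k - 1) * exp (- \<tau> * l ^ m)) = T k l" for l
    proof (cases "l = 0")
      case False
      have "\<bar>l\<bar> powr (\<kappa> + 2 * real k - 1) = \<bar>l\<bar> powr (\<kappa> - 1) * \<bar>l\<bar> powr (real (2 * k))"
        unfolding powr_add[symmetric] by (simp add: algebra_simps)
      also have "\<bar>l\<bar> powr (real (2 * k)) = l ^ (2 * k)"
        using False by (subst powr_realpow) (auto simp: power_even_abs)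
      finally show ?thesis by (simp add: T_def q_def power_mult_distrib)
    qed (simp add: T_def)
    ultimately show ?thesis by simp
  qed
  have [measurable]: "T k \<in> borel_measurable lborel" for k
    by (rule borel_measurable_integrable[OF integrable.intros[OF hb]])
  \<comment> \<open>The term \<open>\<tau>\<close> pays for replacing \<open>l ^ m\<close> by
    \<open>l\<^sup>2 - 1\<close>. The other comes from bounding \<open>\<bar>l * z\<bar>\<close> by
    \<open>\<tau> / 2 * l\<^sup>2 + z\<^sup>2 / (2 * \<tau>)\<close>, which uses up half of the
    Gaussian decay.\<close>
  define C where "C = exp (\<tau> + z\<^sup>2 / (2 * \<tau>))"
  have dom: "exp (- \<tau> * l ^ m) * exp \<bar>l * z\<bar> \<le> C * exp (- (\<tau> / 2) * l ^ 2)" for l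
  proof -
    have "\<bar>l * z\<bar> \<le> \<tau> / 2 * l\<^sup>2 + z\<^sup>2 / (2 * \<tau>)"
    proof -
      have "0 \<le> (\<tau> * \<bar>l\<bar> - \<bar>z\<bar>)\<^sup>2 / (2 * \<tau>)" using \<tau> by simp
      also have "\<dots> = \<tau> / 2 * l\<^sup>2 + z\<^sup>2 / (2 * \<tau>) - \<bar>l * z\<bar>"
        using \<tau> by (simp add: power2_diff field_simps abs_mult) (simp add: power2_eq_square algebra_simps)
      finally show ?thesis by simp
    qed
    moreover have "\<tau> * (l\<^sup>2 - 1) \<le> \<tau> * l ^ m"
      using square_le_even_power[OF m, of l] \<tau> by simp
    ultimately have "- \<tau> * l ^ m + \<bar>l * z\<bar> \<le> (\<tau> + z\<^sup>2 / (2 * \<tau>)) + - (\<tau> / 2) * l ^ 2"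
      by (simp add: algebra_simps)
    then show ?thesis unfolding C_def exp_add[symmetric] by simp
  qed
  have "(\<lambda>N. \<integral>l. (\<Sum>k<N. T k l) \<partial>lborel) \<longlonglongrightarrow> J"
    unfolding J_def
  proof (rule integral_dominated_convergence)
    show "integrable lborel (\<lambda>l. C * (\<bar>l\<bar> powr (\<kappa> - 1) * exp (- (\<tau> / 2) * l ^ 2)))"
      using abs_moment_integral[of \<kappa> "\<tau> / 2" 2] \<kappa> \<tau> by (simp add: has_bochner_integral_iff)
    show "AE l in lborel. (\<lambda>N. \<Sum>k<N. T k l) \<longlonglongrightarrow> \<bar>l\<bar> powr (\<kappa> - 1) * cos (l * z) * exp (- \<tau> * l ^ m)"
    proof (intro always_eventually allI)
      fix l
      have "(\<lambda>k. T k l) sums (\<bar>l\<bar> powr (\<kappa> - 1) * exp (- \<tau> * l ^ m) * cos (l * z))"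
        unfolding T_def by (intro sums_mult cos_paired)
      then show "(\<lambda>N. \<Sum>k<N. T k l) \<longlonglongrightarrow> \<bar>l\<bar> powr (\<kappa> - 1) * cos (l * z) * exp (- \<tau> * l ^ m)"
        by (simp add: sums_def mult_ac)
    qed
    show "AE l in lborel. norm (\<Sum>k<N. T k l) \<le> C * (\<bar>l\<bar> powr (\<kappa> - 1) * exp (- (\<tau> / 2) * l ^ 2))" for N
    proof (intro always_eventually allI)
      fix l
      have "norm (\<Sum>k<N. T k l) \<le> (\<Sum>k<N. norm (T k l))" by (rule norm_sum)
      also have "\<dots> = \<bar>l\<bar> powr (\<kappa> - 1) * exp (- \<tau> * l ^ m) * (\<Sum>k<N. \<bar>l * z\<bar> ^ (2 * k) / fact (2 * k))"
        unfolding sum_distrib_left by (intro sum.cong refl) (simp add: T_def abs_mult power_abs)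
      also have "\<dots> \<le> \<bar>l\<bar> powr (\<kappa> - 1) * exp (- \<tau> * l ^ m) * exp \<bar>l * z\<bar>"
        by (intro mult_left_mono even_exp_partial_sum_le) auto
      also have "\<dots> = \<bar>l\<bar> powr (\<kappa> - 1) * (exp (- \<tau> * l ^ m) * exp \<bar>l * z\<bar>)" by simp
      also have "\<dots> \<le> \<bar>l\<bar> powr (\<kappa> - 1) * (C * exp (- (\<tau> / 2) * l ^ 2))"
        by (intro mult_left_mono dom) auto
      finally show "norm (\<Sum>k<N. T k l) \<le> C * (\<bar>l\<bar> powr (\<kappa> - 1) * exp (- (\<tau> / 2) * l ^ 2))"
        by (simp add: mult_ac)
    qed
  qed simp_all
  moreover have "(\<integral>l. (\<Sum>k<N. T k l) \<partial>lborel) = (\<Sum>k<N. Ik k)" for N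
    using hb by (subst Bochner_Integration.integral_sum) (auto simp: has_bochner_integral_iff)
  ultimately have sums: "Ik sums J" by (simp add: sums_def)
  have Ik: "Ik k = c * (Gamma (\<kappa> / real m + 2 / real m * real k) / Gamma (1/2 + 1 * real k) * y ^ k / fact k)" for k
  proof -
    have e: "(\<kappa> + 2 * real k) / real m = \<kappa> / real m + 2 / real m * real k"
      by (simp add: add_divide_distrib)
    have p: "\<tau> powr (- (\<kappa> / real m + 2 / real m * real k)) = 1 / (\<tau> powr (\<kappa> / real m) * (\<tau> powr (2 / real m)) ^ k)"
    proof -
      have "\<tau> powr (\<kappa> / real m + 2 / real m * real k) = \<tau> powr (\<kappa> / real m) * (\<tau> powr (2 / real m)) ^ k"
        unfolding powr_add powr_powr[symmetric] using \<tau> by (simp add: powr_realpow)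
      then show ?thesis by (simp only: powr_minus_divide)
    qed
    have "Gamma (1/2 + real k) > 0" by (intro Gamma_real_pos) (simp add: add_pos_nonneg)
    then have f: "fact (2 * k) = Gamma (1/2 + real k) * fact k * 4 ^ k / sqrt pi"
      using Gamma_half_fact[of k] by (simp add: field_simps)
    have yk: "y ^ k = (- 1) ^ k * z ^ (2 * k) / (4 ^ k * (\<tau> powr (2 / real m)) ^ k)"
    proof -
      have "y = (- 1) * z\<^sup>2 / (4 * \<tau> powr (2 / real m))" by (simp add: y_def)
      then show ?thesis by (simp only: power_divide power_mult_distrib power_mult)
    qed
    show ?thesis
      unfolding Ik_def q_def c_def e p f yk by (simp, simp only: mult_ac)
  qed
  have "c \<noteq> 0" using \<tau> m by (simp add: c_def)
  have "(\<lambda>k. Gamma (\<kappa> / real m + 2 / real m * real k) / Gamma (1/2 + 1 * real k) * y ^ k / fact k) sums (J / c)"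
    using sums unfolding Ik by (rule sums_mult_D[OF _ \<open>c \<noteq> 0\<close>])
  then have "fox_wright_1_1 (\<kappa> / real m) (2 / real m) (1/2) 1 y = J / c"
    unfolding fox_wright_1_1_def by (rule sums_unique[symmetric])
  then show ?thesis
    using \<open>c \<noteq> 0\<close> unfolding J_def[symmetric] c_def[symmetric] y_def[symmetric] by simp
qed

section \<open>The rescaled field\<close>

definition heat_mode :: "nat \<Rightarrow> real \<Rightarrow> real \<Rightarrow> real \<Rightarrow> complex" where
  "heat_mode m t x l = exp (\<i> * complex_of_real (l * x) - complex_of_real (l ^ m * t))"

lemma heat_mode_measurable [measurable]: "heat_mode m t x \<in> borel_measurable borel"
  unfolding heat_mode_def by (intro borel_measurable_continuous_onI continuous_intros)

lemma heat_mode_polar: "heat_mode m t x l = of_real (exp (- t * l ^ m)) * cis (l * x)"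
  by (simp add: heat_mode_def cis_conv_exp exp_diff exp_minus exp_of_real[symmetric] divide_inverse mult_ac)

lemma norm_heat_mode: "cmod (heat_mode m t x l) = exp (- t * l ^ m)"
  by (simp add: heat_mode_polar norm_mult)

lemma heat_mode_reflect: "even m \<Longrightarrow> heat_mode m t x (- l) = cnj (heat_mode m t x l)"
  by (simp add: heat_mode_polar cis_cnj)

text \<open>The time and space scales are matched so that \<open>\<epsilon>\<close> enters only
  through the frequency; this is the origin of the scale \<open>sqrt \<epsilon>\<close>.\<close>

lemma heat_mode_scale:
  assumes "\<epsilon> > 0"
  shows "heat_mode m (t * \<epsilon> powr (- real m / 2)) (x * \<epsilon> powr (- 1 / 2)) l = heat_mode m t x (l / sqrt \<epsilon>)"
proof -
  have 1: "\<epsilon> powr (- 1 / 2) = 1 / sqrt \<epsilon>"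
    using assms by (simp add: powr_minus_divide powr_half_sqrt)
  have "\<epsilon> powr (- real m / 2) = (\<epsilon> powr (- 1 / 2)) powr real m"
    unfolding powr_powr by simp
  also have "\<dots> = (1 / sqrt \<epsilon>) ^ m"
    unfolding 1 using assms by (intro powr_realpow) simp
  finally show ?thesis
    unfolding heat_mode_def 1 by (simp add: power_divide)
qed

lemma Re_heat_mode_product:
  "Re (heat_mode m t x l * cnj (heat_mode m t' x' l)) = cos (l * (x - x')) * exp (- (t + t') * l ^ m)"
proof -
  have "heat_mode m t x l * cnj (heat_mode m t' x' l)
      = of_real (exp (- t * l ^ m) * exp (- t' * l ^ m)) * (cis (l * x) * cis (- (l * x')))"
    by (simp add: heat_mode_polar cis_cnj)
  also have "\<dots> = of_real (exp (- (t + t') * l ^ m)) * cis (l * (x - x'))"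
    unfolding exp_add[symmetric] cis_mult by (simp add: algebra_simps)
  finally show ?thesis by simp
qed

lemma integrable_exp_even_power:
  assumes \<tau>: "\<tau> > 0" and m: "m > 0" "even m"
  shows "integrable lborel (\<lambda>l::real. exp (- \<tau> * l ^ m))"
proof -
  have "integrable lborel (\<lambda>l::real. \<bar>l\<bar> powr (1 - 1) * exp (- \<tau> * l ^ m))"
    using abs_moment_integral[of 1 \<tau> m] assms by (simp add: has_bochner_integral_iff)
  \<comment> \<open>At \<open>l = 0\<close> the factor \<open>\<bar>l\<bar> powr (1 - 1)\<close> is
    0 instead of 1, so the integrands agree only off the origin.\<close>
  moreover have "AE l in lborel. l \<noteq> (0::real)" by (rule AE_lborel_singleton)
  then have "AE l in lborel. \<bar>l\<bar> powr (1 - 1) * exp (- \<tau> * l ^ m) = exp (- \<tau> * l ^ m)"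
    by eventually_elim simp
  ultimately show ?thesis
    by (subst integrable_cong_AE[where g = "\<lambda>l. \<bar>l\<bar> powr (1 - 1) * exp (- \<tau> * l ^ m)"]) (auto elim: eventually_mono)
qed

text \<open>Supplies the constant \<open>K\<close> that controls the shifted terms:
  \<open>\<bar>l\<bar>\<close> is at most \<open>1 + l ^ m\<close>, and a multiple of
  \<open>exp (\<tau> * l ^ m)\<close> dominates that.\<close>

lemma exp_even_power_times_abs_le:
  fixes \<tau> l :: real
  assumes \<tau>: "\<tau> > 0" and m: "m > 0" "even m"
  shows "exp (- \<tau> * l ^ m) * \<bar>l\<bar> \<le> 1 + 1 / \<tau>"
proof -
  have p: "0 \<le> l ^ m" using m by (simp add: zero_le_even_power)
  have "\<bar>l\<bar> \<le> 1 + l ^ m"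
  proof (cases "\<bar>l\<bar> \<le> 1")
    case False
    then have "\<bar>l\<bar> ^ 1 \<le> \<bar>l\<bar> ^ m" using m by (intro power_increasing) auto
    then show ?thesis using m by (simp add: power_even_abs)
  qed (use p in simp)
  also have "\<dots> \<le> (1 + 1 / \<tau>) * (1 + \<tau> * l ^ m)"
    using \<tau> p by (simp add: field_simps)
  also have "\<dots> \<le> (1 + 1 / \<tau>) * exp (\<tau> * l ^ m)"
    using \<tau> exp_ge_add_one_self[of "\<tau> * l ^ m"] by (intro mult_left_mono) auto
  finally have "exp (- \<tau> * l ^ m) * \<bar>l\<bar> \<le> exp (- \<tau> * l ^ m) * ((1 + 1 / \<tau>) * exp (\<tau> * l ^ m))"
    by (rule mult_left_mono) simp
  also have "\<dots> = (1 + 1 / \<tau>) * exp (- \<tau> * l ^ m + \<tau> * l ^ m)"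
    unfolding exp_add by simp
  finally show ?thesis by simp
qed

text \<open>The smallest of the finitely many times is positive and governs the decay of the whole
  combination; squaring doubles it.\<close>

lemma heat_mode_combination_bound:
  fixes a t x :: "'n::finite \<Rightarrow> real"
  assumes t: "\<And>j. t j > 0" and m: "even m"
  shows "\<exists>\<tau>>0. \<exists>C. \<forall>l. (cmod (\<Sum>j\<in>UNIV. of_real (a j) * heat_mode m (t j) (x j) l))\<^sup>2 \<le> C * exp (- \<tau> * l ^ m)"
proof -
  define t0 where "t0 = Min (range t)"
  define C where "C = (\<Sum>j\<in>UNIV. \<bar>a j\<bar>)"
  have t0: "t0 > 0" "\<And>j. t0 \<le> t j" using t by (auto simp: t0_def)
  have "(cmod (\<Sum>j\<in>UNIV. of_real (a j) * heat_mode m (t j) (x j) l))\<^sup>2 \<le> C\<^sup>2 * exp (- (2 * t0) * l ^ m)" for l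
  proof -
    have p: "0 \<le> l ^ m" using m by (simp add: zero_le_even_power)
    have "cmod (\<Sum>j\<in>UNIV. of_real (a j) * heat_mode m (t j) (x j) l)
        \<le> (\<Sum>j\<in>UNIV. cmod (of_real (a j) * heat_mode m (t j) (x j) l))"
      by (rule norm_sum)
    also have "\<dots> \<le> (\<Sum>j\<in>UNIV. \<bar>a j\<bar> * exp (- t0 * l ^ m))"
      using t0 p by (intro sum_mono) (auto simp: norm_mult norm_heat_mode intro!: mult_left_mono mult_right_mono)
    also have "\<dots> = C * exp (- t0 * l ^ m)" by (simp add: C_def sum_distrib_right)
    finally have "(cmod (\<Sum>j\<in>UNIV. of_real (a j) * heat_mode m (t j) (x j) l))\<^sup>2 \<le> (C * exp (- t0 * l ^ m))\<^sup>2"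
      by (rule power_mono) simp
    also have "\<dots> = C\<^sup>2 * exp (- t0 * l ^ m + - t0 * l ^ m)"
      unfolding exp_add by (simp add: power2_eq_square)
    finally show ?thesis by (simp add: algebra_simps)
  qed
  then show ?thesis using t0(1) by (intro exI[of _ "2 * t0"]) auto
qed

lemma L2c_bounded_mult:
  assumes [measurable]: "g \<in> borel_measurable borel" "p \<in> borel_measurable borel"
    and g: "\<And>l. cmod (g l) \<le> 1" and p: "\<And>l. p l \<ge> 0" "integrable lborel p"
  shows "L2c (\<lambda>l. g l * complex_of_real (sqrt (p l)))"
  unfolding L2c_def
proof
  show "integrable lborel (\<lambda>l. (cmod (g l * complex_of_real (sqrt (p l))))\<^sup>2)"
  proof (rule Bochner_Integration.integrable_bound[OF p(2)])
    show "AE l in lborel. norm ((cmod (g l * complex_of_real (sqrt (p l))))\<^sup>2) \<le> norm (p l)"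
    proof (intro always_eventually allI)
      fix l
      have "(cmod (g l))\<^sup>2 * p l \<le> 1 * p l"
        using g[of l] p(1)[of l] by (intro mult_right_mono) (auto simp: abs_square_le_1)
      then show "norm ((cmod (g l * complex_of_real (sqrt (p l))))\<^sup>2) \<le> norm (p l)"
        using p(1)[of l] by (simp add: norm_mult power_mult_distrib)
    qed
  qed measurable
qed measurable

section \<open>Joint law of finitely many integrals\<close>

context white_noise
begin

text \<open>The characteristic function reduces to one dimension, because an inner product with
  \<open>X\<close> is almost surely the integral of a single Hermitian combination. An almost sure
  representation of \<open>X\<close> is all that the rescaled field can offer.\<close>

lemma gaussian_vector:
  fixes X :: "'a \<Rightarrow> real ^ 'n" and g :: "'n \<Rightarrow> real \<Rightarrow> complex"
  assumes g: "\<And>j. L2c (g j)" "\<And>j. hermitian (g j)"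
    and X: "X \<in> borel_measurable P" "\<And>j. AE \<omega> in P. X \<omega> $ j = b * Re (I (g j) \<omega>)"
  shows gaussian_vector_square_integrable: "integrable P (\<lambda>\<omega>. (norm (X \<omega>))\<^sup>2)"
    and gaussian_vector_second_moment:
      "(\<integral>\<omega>. (norm (X \<omega>))\<^sup>2 \<partial>P) = (\<Sum>j\<in>UNIV. b\<^sup>2 * (\<integral>l. (cmod (g j l))\<^sup>2 \<partial>lborel))"
    and gaussian_vector_char:
      "(\<integral>\<omega>. cis (a \<bullet> X \<omega>) \<partial>P)
        = of_real (exp (- (b\<^sup>2 * (\<integral>l. (cmod (\<Sum>j\<in>UNIV. of_real (a $ j) * g j l))\<^sup>2 \<partial>lborel)) / 2))"
proof -
  note [measurable] = X(1) measurable_I[OF g(1)]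
  have "AE \<omega> in P. \<forall>j\<in>UNIV. X \<omega> $ j = b * Re (I (g j) \<omega>)"
    using X(2) by (intro AE_finite_allI) auto
  then have ae: "AE \<omega> in P. \<forall>j. X \<omega> $ j = b * Re (I (g j) \<omega>)" by simp
  then have sq: "AE \<omega> in P. (norm (X \<omega>))\<^sup>2 = (\<Sum>j\<in>UNIV. b\<^sup>2 * (Re (I (g j) \<omega>))\<^sup>2)"
    by eventually_elim
      (simp add: norm_vec_def L2_set_def sum_nonneg power_mult_distrib)
  have i: "integrable P (\<lambda>\<omega>. b\<^sup>2 * (Re (I (g j) \<omega>))\<^sup>2)" for j
    using I_square_integrable[OF g] by simp
  have "integrable P (\<lambda>\<omega>. (norm (X \<omega>))\<^sup>2) \<longleftrightarrow> integrable P (\<lambda>\<omega>. \<Sum>j\<in>UNIV. b\<^sup>2 * (Re (I (g j) \<omega>))\<^sup>2)"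
    using sq by (intro integrable_cong_AE) auto
  then show "integrable P (\<lambda>\<omega>. (norm (X \<omega>))\<^sup>2)" using i by simp
  have "(\<integral>\<omega>. (norm (X \<omega>))\<^sup>2 \<partial>P) = (\<integral>\<omega>. (\<Sum>j\<in>UNIV. b\<^sup>2 * (Re (I (g j) \<omega>))\<^sup>2) \<partial>P)"
    using sq by (intro integral_cong_AE) auto
  also have "\<dots> = (\<Sum>j\<in>UNIV. b\<^sup>2 * (\<integral>\<omega>. (Re (I (g j) \<omega>))\<^sup>2 \<partial>P))"
    using i by (subst Bochner_Integration.integral_sum) auto
  finally show "(\<integral>\<omega>. (norm (X \<omega>))\<^sup>2 \<partial>P) = (\<Sum>j\<in>UNIV. b\<^sup>2 * (\<integral>l. (cmod (g j l))\<^sup>2 \<partial>lborel))"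
    by (simp add: I_variance[OF g])
  define h where "h = (\<lambda>l. \<Sum>j\<in>UNIV. of_real (a $ j) * g j l)"
  have h: "L2c h" "hermitian h"
    unfolding h_def by (intro L2c_sum hermitian_sum g finite)+
  note [measurable] = measurable_I[OF h(1)]
  have "AE \<omega> in P. I h \<omega> = (\<Sum>j\<in>UNIV. of_real (a $ j) * I (g j) \<omega>)"
    unfolding h_def by (intro I_sum g) auto
  with ae have "AE \<omega> in P. cis (a \<bullet> X \<omega>) = cis (b * Re (I h \<omega>))"
  proof eventually_elim
    case (elim \<omega>)
    then have "a \<bullet> X \<omega> = b * Re (I h \<omega>)"
      by (simp add: inner_vec_def sum_distrib_left mult_ac)
    then show ?case by simp
  qed
  then have "(\<integral>\<omega>. cis (a \<bullet> X \<omega>) \<partial>P) = (\<integral>\<omega>. cis (b * Re (I h \<omega>)) \<partial>P)"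
    by (intro integral_cong_AE) auto
  then show "(\<integral>\<omega>. cis (a \<bullet> X \<omega>) \<partial>P)
        = of_real (exp (- (b\<^sup>2 * (\<integral>l. (cmod (\<Sum>j\<in>UNIV. of_real (a $ j) * g j l))\<^sup>2 \<partial>lborel)) / 2))"
    by (simp only: I_char[OF h]) (simp add: h_def)
qed

end

lemma borel_measurable_vec_lambda:
  fixes f :: "'n::finite \<Rightarrow> 'a \<Rightarrow> real"
  assumes "\<And>j. f j \<in> borel_measurable M"
  shows "(\<lambda>\<omega>. \<chi> j. f j \<omega>) \<in> borel_measurable M"
  using assms by (subst borel_measurable_euclidean_space) (auto simp: Basis_vec_def inner_axis)

text \<open>Valid at the origin too, where both sides are 0 by the conventions for division by 0 and
  for \<open>powr\<close> with base 0.\<close>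

lemma limit_mode_norm:
  "(cmod (z / complex_of_real (\<bar>l\<bar> powr ((1 - \<kappa>) / 2))))\<^sup>2 = (cmod z)\<^sup>2 * \<bar>l\<bar> powr (\<kappa> - 1)"
proof -
  have "(\<bar>l\<bar> powr ((1 - \<kappa>) / 2))\<^sup>2 = \<bar>l\<bar> powr (1 - \<kappa>)"
    by (simp add: power2_eq_square powr_add[symmetric])
  then have "(cmod (z / complex_of_real (\<bar>l\<bar> powr ((1 - \<kappa>) / 2))))\<^sup>2 = (cmod z)\<^sup>2 * (1 / \<bar>l\<bar> powr (1 - \<kappa>))"
    by (simp add: norm_divide power_divide)
  also have "1 / \<bar>l\<bar> powr (1 - \<kappa>) = \<bar>l\<bar> powr (\<kappa> - 1)"
    by (simp add: powr_minus_divide[symmetric])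
  finally show ?thesis .
qed

lemma L2c_limit_mode:
  assumes "t > 0" "\<kappa> > 0" "m > 0" "even m"
  shows "L2c (\<lambda>l. heat_mode m t x l / complex_of_real (\<bar>l\<bar> powr ((1 - \<kappa>) / 2)))"
  unfolding L2c_def limit_mode_norm
proof
  have eq: "(cmod (heat_mode m t x l))\<^sup>2 * \<bar>l\<bar> powr (\<kappa> - 1) = \<bar>l\<bar> powr (\<kappa> - 1) * exp (- (2 * t) * l ^ m)" for l
    unfolding norm_heat_mode power2_eq_square exp_add[symmetric] by (simp add: algebra_simps)
  show "integrable lborel (\<lambda>l. (cmod (heat_mode m t x l))\<^sup>2 * \<bar>l\<bar> powr (\<kappa> - 1))"
    unfolding eq using abs_moment_integral[of \<kappa> "2 * t" m] assms by (simp add: has_bochner_integral_iff)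
qed measurable

lemma hermitian_limit_mode:
  "even m \<Longrightarrow> hermitian (\<lambda>l. heat_mode m t x l / complex_of_real (\<bar>l\<bar> powr ((1 - \<kappa>) / 2)))"
  by (simp add: hermitian_def heat_mode_reflect)

lemma Re_U_zero:
  "Re (U_zero I m A0 \<kappa> t x \<omega>)
    = sqrt (A0 * c2 \<kappa>) * Re (I (\<lambda>l. heat_mode m t x l / complex_of_real (\<bar>l\<bar> powr ((1 - \<kappa>) / 2))) \<omega>)"
  by (simp add: U_zero_def heat_mode_def)

section \<open>The rescaled solution and the limit field\<close>

context white_noise
begin

text \<open>The integrand built from \<open>f\<close> need not be Hermitian, as \<open>f\<close> is
  even only up to a null set. Its mean and integrability are therefore taken from \<open>h\<close>,
  built from the even \<open>F\<close>. The contribution of \<open>M\<close> is the constant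
  \<open>D\<close> and cancels on centring.\<close>

lemma Re_U_eps:
  fixes x :: real and f F :: "real \<Rightarrow> real"
  assumes \<epsilon>: "\<epsilon> > 0" and t: "t > 0" and m: "even m"
    and f: "f \<in> borel_measurable lborel" "\<And>l. f l \<ge> 0" "integrable lborel f"
    and F: "\<And>l. F l \<ge> 0" "integrable lborel F" "\<And>l. F (- l) = F l"
    and fF: "AE l in lborel. f l = F l"
  defines "h \<equiv> \<lambda>l. heat_mode m t x (l / sqrt \<epsilon>) * complex_of_real (sqrt (F l))"
  shows "L2c h" "hermitian h" "(\<lambda>\<omega>. Re (U_eps P M I f m \<kappa> \<epsilon> t x \<omega>)) \<in> borel_measurable P"
    "AE \<omega> in P. Re (U_eps P M I f m \<kappa> \<epsilon> t x \<omega>) = \<epsilon> powr (- \<kappa> / 4) * Re (I h \<omega>)"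
proof -
  define g where "g = (\<lambda>l. heat_mode m t x (l / sqrt \<epsilon>) * complex_of_real (sqrt (f l)))"
  note [measurable] = borel_measurable_integrable[OF F(2)]
  have [measurable]: "f \<in> borel_measurable borel" using f(1) by simp
  have le: "cmod (heat_mode m t x (l / sqrt \<epsilon>)) \<le> 1" for l
    using t m by (simp add: norm_heat_mode zero_le_even_power)
  have g: "L2c g"
    unfolding g_def by (rule L2c_bounded_mult) (use le f in measurable)
  show h: "L2c h"
    unfolding h_def by (rule L2c_bounded_mult) (use le F in measurable)
  show herm: "hermitian h"
    using m F(3) by (simp add: hermitian_def h_def heat_mode_reflect)
  have ae: "AE \<omega> in P. I g \<omega> = I h \<omega>"
    by (rule I_cong_AE[OF g h]) (use fF in \<open>auto simp: g_def h_def\<close>)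
  note [measurable] = measurable_I[OF g] measurable_I[OF h]
  have "integrable P (I g) \<longleftrightarrow> integrable P (I h)"
    using ae by (intro integrable_cong_AE) auto
  then have ig: "integrable P (I g)" using I_expectation(2)[OF h herm] by simp
  have "(\<integral>\<omega>. I g \<omega> \<partial>P) = (\<integral>\<omega>. I h \<omega> \<partial>P)"
    using ae by (intro integral_cong_AE) auto
  then have Eg: "(\<integral>\<omega>. I g \<omega> \<partial>P) = 0" using I_expectation(1)[OF h herm] by simp
  define D where "D = integral\<^sup>L lborel (\<lambda>y. complex_of_real (M (x * \<epsilon> powr (- 1 / 2) - y)) * um m (t * \<epsilon> powr (- real m / 2)) y)"
  have sol: "heat_sol M I f m (t * \<epsilon> powr (- real m / 2)) (x * \<epsilon> powr (- 1 / 2)) \<omega> = D + I g \<omega>" for \<omega>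
    unfolding heat_sol_def D_def g_def heat_mode_scale[OF \<epsilon>, symmetric] by (simp add: heat_mode_def)
  have "(\<integral>\<omega>. D + I g \<omega> \<partial>P) = D"
    using ig Eg by (simp add: prob_space)
  then have U: "Re (U_eps P M I f m \<kappa> \<epsilon> t x \<omega>) = \<epsilon> powr (- \<kappa> / 4) * Re (I g \<omega>)" for \<omega>
    unfolding U_eps_def sol by simp
  show "(\<lambda>\<omega>. Re (U_eps P M I f m \<kappa> \<epsilon> t x \<omega>)) \<in> borel_measurable P"
    unfolding U by measurable
  show "AE \<omega> in P. Re (U_eps P M I f m \<kappa> \<epsilon> t x \<omega>) = \<epsilon> powr (- \<kappa> / 4) * Re (I h \<omega>)"
    unfolding U using ae by eventually_elim simp
qed

lemma U_zero_mean:
  assumes "t > 0" "\<kappa> > 0" "m > 0" "even m"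
  shows "(\<integral>\<omega>. Re (U_zero I m A0 \<kappa> t x \<omega>) \<partial>P) = 0"
  unfolding Re_U_zero using I_mean[OF L2c_limit_mode hermitian_limit_mode] assms by simp

lemma U_zero_covariance:
  assumes "t > 0" "t' > 0" "\<kappa> > 0" "m > 0" "even m" "A0 * c2 \<kappa> \<ge> 0"
  shows "(\<integral>\<omega>. Re (U_zero I m A0 \<kappa> t x \<omega>) * Re (U_zero I m A0 \<kappa> t' x' \<omega>) \<partial>P)
    = A0 * c2 \<kappa> * (\<integral>l. \<bar>l\<bar> powr (\<kappa> - 1) * cos (l * (x - x')) * exp (- (t + t') * l ^ m) \<partial>lborel)"
proof -
  let ?h = "\<lambda>t x l. heat_mode m t x l / complex_of_real (\<bar>l\<bar> powr ((1 - \<kappa>) / 2))"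
  have "Re (U_zero I m A0 \<kappa> t x \<omega>) * Re (U_zero I m A0 \<kappa> t' x' \<omega>)
      = A0 * c2 \<kappa> * (Re (I (?h t x) \<omega>) * Re (I (?h t' x') \<omega>))" for \<omega>
  proof -
    have "s * y * (s * z) = s * s * (y * z)" for s y z :: real by simp
    moreover have "sqrt (A0 * c2 \<kappa>) * sqrt (A0 * c2 \<kappa>) = A0 * c2 \<kappa>" using assms(6) by simp
    ultimately show ?thesis by (simp only: Re_U_zero)
  qed
  then have "(\<integral>\<omega>. Re (U_zero I m A0 \<kappa> t x \<omega>) * Re (U_zero I m A0 \<kappa> t' x' \<omega>) \<partial>P)
      = A0 * c2 \<kappa> * (\<integral>\<omega>. Re (I (?h t x) \<omega>) * Re (I (?h t' x') \<omega>) \<partial>P)"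
    by (simp only: integral_mult_right_zero)
  also have "(\<integral>\<omega>. Re (I (?h t x) \<omega>) * Re (I (?h t' x') \<omega>) \<partial>P) = (\<integral>l. Re (?h t x l * cnj (?h t' x' l)) \<partial>lborel)"
    using assms by (intro I_covariance L2c_limit_mode hermitian_limit_mode)
  also have "\<dots> = (\<integral>l. \<bar>l\<bar> powr (\<kappa> - 1) * cos (l * (x - x')) * exp (- (t + t') * l ^ m) \<partial>lborel)"
  proof (rule Bochner_Integration.integral_cong)
    fix l
    have 1: "\<bar>l\<bar> powr ((1 - \<kappa>) / 2) * \<bar>l\<bar> powr ((1 - \<kappa>) / 2) = \<bar>l\<bar> powr (1 - \<kappa>)"
      by (simp add: powr_add[symmetric])
    have 2: "1 / \<bar>l\<bar> powr (1 - \<kappa>) = \<bar>l\<bar> powr (\<kappa> - 1)"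
      by (simp add: powr_minus_divide[symmetric])
    have "?h t x l * cnj (?h t' x' l) = (heat_mode m t x l * cnj (heat_mode m t' x' l))
        / of_real (\<bar>l\<bar> powr ((1 - \<kappa>) / 2) * \<bar>l\<bar> powr ((1 - \<kappa>) / 2))"
      by simp
    then have "Re (?h t x l * cnj (?h t' x' l)) = Re (heat_mode m t x l * cnj (heat_mode m t' x' l)) * (1 / \<bar>l\<bar> powr (1 - \<kappa>))"
      unfolding 1 by (simp only: Re_divide_of_real) simp
    then show "Re (?h t x l * cnj (?h t' x' l)) = \<bar>l\<bar> powr (\<kappa> - 1) * cos (l * (x - x')) * exp (- (t + t') * l ^ m)"
      unfolding 2 Re_heat_mode_product by simp
  qed simp
  finally show ?thesis .
qed

end

theorem theorem3:
  fixes P :: "'a measure"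
    and I :: "(real \<Rightarrow> complex) \<Rightarrow> 'a \<Rightarrow> complex"
    and M :: "real \<Rightarrow> real"
    and f :: "real \<Rightarrow> real"
    and k :: nat and m :: nat
    and n :: nat and A :: "nat \<Rightarrow> real" and w :: "nat \<Rightarrow> real" and \<kappa> :: "nat \<Rightarrow> real"
  assumes m_def: "m = 2 * k" and k_pos: "k \<ge> 1"
    and W: "complex_white_noise_integral P I"
    and A_nonneg: "\<forall>j\<le>n. A j \<ge> 0"
    and A_sum: "(\<Sum>j=0..n. A j) = 1"
    and w0: "w 0 = 0" and w_nz: "\<forall>j. 1 \<le> j \<and> j \<le> n \<longrightarrow> w j \<noteq> 0"
    and \<kappa>_range: "\<forall>j\<le>n. 0 < \<kappa> j \<and> \<kappa> j < 1"
    and A0: "A 0 \<noteq> 0"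
    and f_meas: "f \<in> borel_measurable lborel"
    and f_nonneg: "\<forall>l. f l \<ge> 0"
    and f_int: "integrable lborel f"
    and f_spec: "\<forall>x. integral\<^sup>L lborel (\<lambda>l. exp (\<i> * complex_of_real (l * x)) * complex_of_real (f l))
                    = complex_of_real (cov_B n A w \<kappa> x)"
    and M_conv: "\<forall>t>0. \<forall>x. integrable lborel (\<lambda>y. complex_of_real (M (x - y)) * um m t y)"
  shows
    "(\<forall>(pts :: 'n::finite \<Rightarrow> real \<times> real) (g :: real ^ 'n \<Rightarrow> real).
        (\<forall>j. fst (pts j) > 0) \<longrightarrow> continuous_on UNIV g \<longrightarrow> bounded (range g) \<longrightarrow>
        ((\<lambda>\<epsilon>. integral\<^sup>L P (\<lambda>\<omega>. g (\<chi> j. Re (U_eps P M I f m (\<kappa> 0) \<epsilon> (fst (pts j)) (snd (pts j)) \<omega>))))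
          \<longlongrightarrow> integral\<^sup>L P (\<lambda>\<omega>. g (\<chi> j. Re (U_zero I m (A 0) (\<kappa> 0) (fst (pts j)) (snd (pts j)) \<omega>))))
          (at_right 0))
     \<and> (\<forall>t x. t > 0 \<longrightarrow> integral\<^sup>L P (\<lambda>\<omega>. Re (U_zero I m (A 0) (\<kappa> 0) t x \<omega>)) = 0)
     \<and> (\<forall>t x t' x'. t > 0 \<longrightarrow> t' > 0 \<longrightarrow>
          integral\<^sup>L P (\<lambda>\<omega>. Re (U_zero I m (A 0) (\<kappa> 0) t x \<omega>) * Re (U_zero I m (A 0) (\<kappa> 0) t' x' \<omega>))
            - integral\<^sup>L P (\<lambda>\<omega>. Re (U_zero I m (A 0) (\<kappa> 0) t x \<omega>))
              * integral\<^sup>L P (\<lambda>\<omega>. Re (U_zero I m (A 0) (\<kappa> 0) t' x' \<omega>))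
          = A 0 * c2 (\<kappa> 0) * integral\<^sup>L lborel
               (\<lambda>l. \<bar>l\<bar> powr (\<kappa> 0 - 1) * cos (l * (x - x')) * exp (- (t + t') * l ^ m))
        \<and> A 0 * c2 (\<kappa> 0) * integral\<^sup>L lborel
               (\<lambda>l. \<bar>l\<bar> powr (\<kappa> 0 - 1) * cos (l * (x - x')) * exp (- (t + t') * l ^ m))
          = 2 * sqrt pi * A 0 * c2 (\<kappa> 0) / (real m * (t + t') powr (\<kappa> 0 / real m))
            * fox_wright_1_1 (\<kappa> 0 / real m) (2 / real m) (1 / 2) 1
                (- (x - x')\<^sup>2 / (4 * (t + t') powr (2 / real m))))"
proof -
  interpret white_noise P I by unfold_locales (rule W)
  have m: "m > 0" "even m" using m_def k_pos by auto
  have \<kappa>0: "0 < \<kappa> 0" "\<kappa> 0 < 1" using \<kappa>_range by auto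
  have s0: "A 0 * c2 (\<kappa> 0) \<ge> 0" using A_nonneg c2_nonneg[OF \<kappa>0] by simp
  have An: "\<And>j. j \<le> n \<Longrightarrow> A j \<ge> 0" and kr: "\<And>j. j \<le> n \<Longrightarrow> 0 < \<kappa> j" "\<And>j. j \<le> n \<Longrightarrow> \<kappa> j < 1"
    using A_nonneg \<kappa>_range by auto
  define F where "F = spectral_density n A w \<kappa>"
  have F: "\<And>l. F l \<ge> 0" "integrable lborel F" "\<And>l. F (- l) = F l"
    unfolding F_def by (intro spectral_density_nonneg integrable_spectral_density spectral_density_even An kr; assumption)+
  have fs: "(\<integral>l. f l *\<^sub>R cis (x * l) \<partial>lborel) = of_real (cov_B n A w \<kappa> x)" for x
    using f_spec[rule_format, of x] by (simp add: cis_conv_exp scaleR_conv_of_real mult.commute)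
  have fF: "AE l in lborel. f l = F l"
  proof (rule fourier_density_unique)
    \<comment> \<open>The mass of \<open>f\<close> is the covariance at 0, which is the sum of the
      weights \<open>A j\<close>.\<close>
    have "complex_of_real (integral\<^sup>L lborel f) = of_real (cov_B n A w \<kappa> 0)"
      using fs[of 0] by (simp add: scaleR_conv_of_real)
    then show "integral\<^sup>L lborel f = 1"
      using A_sum by (simp only: of_real_eq_iff) (simp add: cov_B_def)
    show "(\<integral>l. f l *\<^sub>R cis (x * l) \<partial>lborel) = (\<integral>l. F l *\<^sub>R cis (x * l) \<partial>lborel)" for x
      unfolding fs F_def by (rule spectral_density_fourier[symmetric]) (auto simp: An kr)
  qed (use f_int f_nonneg F in auto)
  have fdd: "((\<lambda>\<epsilon>. \<integral>\<omega>. g (\<chi> j. Re (U_eps P M I f m (\<kappa> 0) \<epsilon> (fst (pts j)) (snd (pts j)) \<omega>)) \<partial>P)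
          \<longlongrightarrow> (\<integral>\<omega>. g (\<chi> j. Re (U_zero I m (A 0) (\<kappa> 0) (fst (pts j)) (snd (pts j)) \<omega>)) \<partial>P)) (at_right 0)"
    if pts: "\<And>j. fst (pts j) > 0" and g: "continuous_on UNIV g" "bounded (range g)"
    for pts :: "'n \<Rightarrow> real \<times> real" and g :: "real ^ 'n \<Rightarrow> real"
  proof -
    define X where "X = (\<lambda>\<epsilon> \<omega>. \<chi> j. Re (U_eps P M I f m (\<kappa> 0) \<epsilon> (fst (pts j)) (snd (pts j)) \<omega>))"
    define Y where "Y = (\<lambda>\<omega>. \<chi> j. Re (U_zero I m (A 0) (\<kappa> 0) (fst (pts j)) (snd (pts j)) \<omega>))"
    define e where "e = (\<lambda>j. heat_mode m (fst (pts j)) (snd (pts j)))"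
    define h where "h = (\<lambda>\<epsilon> j l. e j (l / sqrt \<epsilon>) * complex_of_real (sqrt (F l)))"
    define y where "y = (\<lambda>j l. e j l / complex_of_real (\<bar>l\<bar> powr ((1 - \<kappa> 0) / 2)))"
    define b where "b = (\<lambda>\<epsilon>::real. \<epsilon> powr (- \<kappa> 0 / 4))"
    define s where "s = sqrt (A 0 * c2 (\<kappa> 0))"
    have Xae: "X \<epsilon> \<in> borel_measurable P" "\<And>j. L2c (h \<epsilon> j)" "\<And>j. hermitian (h \<epsilon> j)"
        "\<And>j. AE \<omega> in P. X \<epsilon> \<omega> $ j = b \<epsilon> * Re (I (h \<epsilon> j) \<omega>)" if "\<epsilon> > 0" for \<epsilon>
    proof -
      note * = Re_U_eps[OF that pts m(2) f_meas _ f_int F fF]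
      show "X \<epsilon> \<in> borel_measurable P"
        unfolding X_def using f_nonneg by (intro borel_measurable_vec_lambda *) auto
      show "L2c (h \<epsilon> j)" "hermitian (h \<epsilon> j)" for j
        unfolding h_def e_def using f_nonneg by (intro *; auto)+
      show "AE \<omega> in P. X \<epsilon> \<omega> $ j = b \<epsilon> * Re (I (h \<epsilon> j) \<omega>)" for j
        unfolding X_def h_def e_def b_def vec_lambda_beta using f_nonneg by (intro *) auto
    qed
    have yj: "\<And>j. L2c (y j)" "\<And>j. hermitian (y j)"
      unfolding y_def e_def using m pts \<kappa>0 by (intro L2c_limit_mode hermitian_limit_mode; auto)+
    have Yae: "Y \<omega> $ j = s * Re (I (y j) \<omega>)" for \<omega> j
      by (simp add: Y_def Re_U_zero y_def e_def s_def)
    have Yj: "AE \<omega> in P. Y \<omega> $ j = s * Re (I (y j) \<omega>)" for j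
      by (simp add: Yae)
    have Ym: "Y \<in> borel_measurable P"
    proof -
      have "(\<lambda>\<omega>. s * Re (I (y j) \<omega>)) \<in> borel_measurable P" for j
        using measurable_I[OF yj(1)] by measurable
      then have "(\<lambda>\<omega>. \<chi> j. s * Re (I (y j) \<omega>)) \<in> borel_measurable P"
        by (rule borel_measurable_vec_lambda)
      moreover have "Y = (\<lambda>\<omega>. \<chi> j. s * Re (I (y j) \<omega>))"
        by (auto simp: vec_eq_iff Yae)
      ultimately show ?thesis by simp
    qed
    \<comment> \<open>\<open>\<Phi> a\<close> carries only the heat modes, so the variances before
      and in the limit are integrals of this one function, against \<open>F\<close> after rescaling
      and against the pure power.\<close>
    define \<Phi> where "\<Phi> = (\<lambda>a l. (cmod (\<Sum>j\<in>UNIV. of_real (a j) * e j l))\<^sup>2)"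
    have hsum: "(cmod (\<Sum>j\<in>UNIV. of_real (a j) * h \<epsilon> j l))\<^sup>2 = \<Phi> a (l / sqrt \<epsilon>) * F l" for a \<epsilon> l
    proof -
      have "(\<Sum>j\<in>UNIV. of_real (a j) * h \<epsilon> j l) = (\<Sum>j\<in>UNIV. of_real (a j) * e j (l / sqrt \<epsilon>)) * complex_of_real (sqrt (F l))"
        by (simp add: h_def sum_distrib_right mult.assoc)
      then show ?thesis using F(1)[of l] by (simp add: \<Phi>_def norm_mult power_mult_distrib)
    qed
    have ysum: "(cmod (\<Sum>j\<in>UNIV. of_real (a j) * y j l))\<^sup>2 = \<Phi> a l * \<bar>l\<bar> powr (\<kappa> 0 - 1)" for a l
    proof -
      have "(\<Sum>j\<in>UNIV. of_real (a j) * y j l) = (\<Sum>j\<in>UNIV. of_real (a j) * e j l) / complex_of_real (\<bar>l\<bar> powr ((1 - \<kappa> 0) / 2))"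
        by (simp add: y_def sum_divide_distrib)
      then show ?thesis by (simp add: \<Phi>_def limit_mode_norm)
    qed
    \<comment> \<open>This limit serves twice: \<open>a\<close> as the frequency vector gives the
      exponents of the characteristic functions, \<open>a\<close> as a unit vector the second
      moments.\<close>
    have scal: "((\<lambda>\<epsilon>. (b \<epsilon>)\<^sup>2 * (\<integral>l. \<Phi> a (l / sqrt \<epsilon>) * F l \<partial>lborel)) \<longlongrightarrow> s\<^sup>2 * (\<integral>l. \<Phi> a l * \<bar>l\<bar> powr (\<kappa> 0 - 1) \<partial>lborel)) (at_right 0)"
      for a :: "'n \<Rightarrow> real"
    proof -
      obtain C \<tau> where C: "\<tau> > 0" "\<And>l. \<Phi> a l \<le> C * exp (- \<tau> * l ^ m)"
        using heat_mode_combination_bound[of "\<lambda>j. fst (pts j)" m a "\<lambda>j. snd (pts j)", OF pts m(2)]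
        unfolding \<Phi>_def e_def by blast
      have \<Phi>0: "0 \<le> \<Phi> a l" for l by (simp add: \<Phi>_def)
      have C0: "C \<ge> 0" using order_trans[OF \<Phi>0 C(2)[of 0]] by (simp add: zero_le_mult_iff)
      have [measurable]: "\<Phi> a \<in> borel_measurable borel"
        unfolding \<Phi>_def e_def by measurable
      have i1: "integrable lborel (\<Phi> a)"
      proof (rule Bochner_Integration.integrable_bound)
        show "integrable lborel (\<lambda>l. C * exp (- \<tau> * l ^ m))"
          using integrable_exp_even_power[OF C(1) m] by simp
        show "AE l in lborel. norm (\<Phi> a l) \<le> norm (C * exp (- \<tau> * l ^ m))"
          using C(2) \<Phi>0 C0 by (intro always_eventually allI) (simp add: abs_mult)
      qed measurable
      have i2: "integrable lborel (\<lambda>l. \<Phi> a l * \<bar>l\<bar> powr (\<kappa> 0 - 1))"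
      proof (rule Bochner_Integration.integrable_bound)
        show "integrable lborel (\<lambda>l. C * (\<bar>l\<bar> powr (\<kappa> 0 - 1) * exp (- \<tau> * l ^ m)))"
          using abs_moment_integral[OF \<kappa>0(1) C(1) m] by (simp add: has_bochner_integral_iff)
        show "AE l in lborel. norm (\<Phi> a l * \<bar>l\<bar> powr (\<kappa> 0 - 1)) \<le> norm (C * (\<bar>l\<bar> powr (\<kappa> 0 - 1) * exp (- \<tau> * l ^ m)))"
        proof (intro always_eventually allI)
          fix l
          have "\<Phi> a l * \<bar>l\<bar> powr (\<kappa> 0 - 1) \<le> C * exp (- \<tau> * l ^ m) * \<bar>l\<bar> powr (\<kappa> 0 - 1)"
            using C(2) by (intro mult_right_mono) auto
          then show "norm (\<Phi> a l * \<bar>l\<bar> powr (\<kappa> 0 - 1)) \<le> norm (C * (\<bar>l\<bar> powr (\<kappa> 0 - 1) * exp (- \<tau> * l ^ m)))"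
            using \<Phi>0 C0 by (simp add: abs_mult mult_ac)
        qed
      qed measurable
      have le: "\<Phi> a l \<le> C" for l
      proof -
        have "exp (- \<tau> * l ^ m) \<le> 1" using C(1) m by (simp add: zero_le_even_power)
        then have "C * exp (- \<tau> * l ^ m) \<le> C * 1" using C0 by (intro mult_left_mono)
        then show ?thesis using C(2)[of l] by simp
      qed
      have leK: "\<Phi> a l * \<bar>l\<bar> \<le> C * (1 + 1 / \<tau>)" for l
      proof -
        have "\<Phi> a l * \<bar>l\<bar> \<le> C * exp (- \<tau> * l ^ m) * \<bar>l\<bar>"
          using C(2) by (intro mult_right_mono) auto
        also have "\<dots> = C * (exp (- \<tau> * l ^ m) * \<bar>l\<bar>)" by simp
        also have "\<dots> \<le> C * (1 + 1 / \<tau>)"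
          using C0 by (intro mult_left_mono exp_even_power_times_abs_le C m)
        finally show ?thesis .
      qed
      have s2: "s\<^sup>2 = A 0 * c2 (\<kappa> 0)" using s0 by (simp add: s_def)
      have b2: "(b \<epsilon>)\<^sup>2 = sqrt \<epsilon> powr (- \<kappa> 0)" if "\<epsilon> > 0" for \<epsilon>
        using that by (simp add: b_def power2_eq_square powr_add[symmetric] powr_half_sqrt[symmetric] powr_powr)
      show ?thesis
        \<comment> \<open>The scaling limits were obtained along sequences, as dominated convergence
          requires, so the one-sided limit is tested on sequences of positive numbers.\<close>
        unfolding tendsto_at_iff_sequentially
      proof (intro allI impI)
        fix Z :: "nat \<Rightarrow> real" assume Z: "\<forall>i. Z i \<in> {0<..} - {0}" "Z \<longlonglongrightarrow> 0"
        have Zp: "Z i > 0" for i using Z(1) by auto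
        have "(\<lambda>i. sqrt (Z i)) \<longlonglongrightarrow> sqrt 0" by (intro tendsto_intros Z)
        then have "(\<lambda>i. sqrt (Z i) powr (- \<kappa> 0) * (\<integral>l. \<Phi> a (l / sqrt (Z i)) * spectral_density n A w \<kappa> l \<partial>lborel))
          \<longlonglongrightarrow> A 0 * c2 (\<kappa> 0) * (\<integral>l. \<Phi> a l * \<bar>l\<bar> powr (\<kappa> 0 - 1) \<partial>lborel)"
          using An kr w0 w_nz i1 i2 \<Phi>0 le leK Zp by (intro spectral_scaling) auto
        then show "((\<lambda>\<epsilon>. (b \<epsilon>)\<^sup>2 * (\<integral>l. \<Phi> a (l / sqrt \<epsilon>) * F l \<partial>lborel)) \<circ> Z) \<longlonglongrightarrow> s\<^sup>2 * (\<integral>l. \<Phi> a l * \<bar>l\<bar> powr (\<kappa> 0 - 1) \<partial>lborel)"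
          by (simp add: comp_def b2[OF Zp] s2 F_def)
      qed
    qed
    have pos: "\<forall>\<^sub>F \<epsilon> in at_right 0. (0::real) < \<epsilon>" by (rule eventually_at_right_less)
    \<comment> \<open>For a unit vector, \<open>\<Phi> (u j)\<close> is the squared modulus of the
      single mode \<open>j\<close>, so the second moment of \<open>X \<epsilon>\<close> is a sum of
      instances of \<open>scal\<close>.\<close>
    define u where "u = (\<lambda>(i::'n) j. if j = i then 1 else 0 :: real)"
    have u: "(\<Sum>j\<in>UNIV. complex_of_real (u i j) * q j) = q i" for i q
      by (simp add: u_def if_distrib[where f = of_real] if_distrib[where f = "\<lambda>x. x * _"] cong: if_cong)
    define V where "V = (\<Sum>j\<in>UNIV. s\<^sup>2 * (\<integral>l. \<Phi> (u j) l * \<bar>l\<bar> powr (\<kappa> 0 - 1) \<partial>lborel))"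
    have EX: "(\<integral>\<omega>. (norm (X \<epsilon> \<omega>))\<^sup>2 \<partial>P) = (\<Sum>j\<in>UNIV. (b \<epsilon>)\<^sup>2 * (\<integral>l. \<Phi> (u j) (l / sqrt \<epsilon>) * F l \<partial>lborel))" if "\<epsilon> > 0" for \<epsilon>
      using gaussian_vector_second_moment[of "h \<epsilon>" "X \<epsilon>" "b \<epsilon>", OF Xae(2,3)[OF that] Xae(1,4)[OF that]]
      by (simp add: hsum[symmetric] u)
    have EY: "(\<integral>\<omega>. (norm (Y \<omega>))\<^sup>2 \<partial>P) = V"
      using gaussian_vector_second_moment[of y Y s, OF yj Ym Yj] by (simp add: V_def ysum[symmetric] u)
    have limV: "((\<lambda>\<epsilon>. \<Sum>j\<in>UNIV. (b \<epsilon>)\<^sup>2 * (\<integral>l. \<Phi> (u j) (l / sqrt \<epsilon>) * F l \<partial>lborel)) \<longlongrightarrow> V) (at_right 0)"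
      unfolding V_def by (intro tendsto_sum scal)
    have "((\<lambda>\<epsilon>. \<integral>\<omega>. g (X \<epsilon> \<omega>) \<partial>P) \<longlongrightarrow> (\<integral>\<omega>. g (Y \<omega>) \<partial>P)) (at_right 0)"
    \<comment> \<open>The second moments tend to \<open>V\<close>, so they are eventually below
      \<open>V + 1\<close>.\<close>
    proof (rule tendsto_expectation_of_char[where V = "V + 1", OF _ Ym _ _ _ g])
      have "\<forall>\<^sub>F \<epsilon> in at_right 0. (\<Sum>j\<in>UNIV. (b \<epsilon>)\<^sup>2 * (\<integral>l. \<Phi> (u j) (l / sqrt \<epsilon>) * F l \<partial>lborel)) < V + 1"
        using limV by (rule order_tendstoD) simp
      with pos show "\<forall>\<^sub>F \<epsilon> in at_right 0. X \<epsilon> \<in> borel_measurable P \<and> integrable P (\<lambda>\<omega>. (norm (X \<epsilon> \<omega>))\<^sup>2)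
          \<and> (\<integral>\<omega>. (norm (X \<epsilon> \<omega>))\<^sup>2 \<partial>P) \<le> V + 1"
      proof eventually_elim
        case (elim \<epsilon>)
        then show ?case
          using gaussian_vector_square_integrable[of "h \<epsilon>" "X \<epsilon>" "b \<epsilon>", OF Xae(2,3) Xae(1,4)] Xae(1) EX by simp
      qed
      show "integrable P (\<lambda>\<omega>. (norm (Y \<omega>))\<^sup>2)"
        by (rule gaussian_vector_square_integrable[of y Y s, OF yj Ym Yj])
      show "(\<integral>\<omega>. (norm (Y \<omega>))\<^sup>2 \<partial>P) \<le> V + 1" by (simp add: EY)
      fix a :: "real ^ 'n"
      have cY: "(\<integral>\<omega>. cis (a \<bullet> Y \<omega>) \<partial>P) = of_real (exp (- (s\<^sup>2 * (\<integral>l. \<Phi> (($) a) l * \<bar>l\<bar> powr (\<kappa> 0 - 1) \<partial>lborel)) / 2))"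
        using gaussian_vector_char[of y Y s, OF yj Ym Yj] by (simp add: ysum)
      have cX: "(\<integral>\<omega>. cis (a \<bullet> X \<epsilon> \<omega>) \<partial>P) = of_real (exp (- ((b \<epsilon>)\<^sup>2 * (\<integral>l. \<Phi> (($) a) (l / sqrt \<epsilon>) * F l \<partial>lborel)) / 2))" if "\<epsilon> > 0" for \<epsilon>
        using gaussian_vector_char[of "h \<epsilon>" "X \<epsilon>" "b \<epsilon>", OF Xae(2,3)[OF that] Xae(1,4)[OF that]] by (simp add: hsum)
      show "((\<lambda>\<epsilon>. \<integral>\<omega>. cis (a \<bullet> X \<epsilon> \<omega>) \<partial>P) \<longlongrightarrow> (\<integral>\<omega>. cis (a \<bullet> Y \<omega>) \<partial>P)) (at_right 0)"
      proof (rule Lim_transform_eventually)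
        show "((\<lambda>\<epsilon>. complex_of_real (exp (- ((b \<epsilon>)\<^sup>2 * (\<integral>l. \<Phi> (($) a) (l / sqrt \<epsilon>) * F l \<partial>lborel)) / 2))) \<longlongrightarrow> (\<integral>\<omega>. cis (a \<bullet> Y \<omega>) \<partial>P)) (at_right 0)"
          unfolding cY by (intro tendsto_of_real tendsto_exp tendsto_divide tendsto_minus scal tendsto_const) simp
        show "\<forall>\<^sub>F \<epsilon> in at_right 0. complex_of_real (exp (- ((b \<epsilon>)\<^sup>2 * (\<integral>l. \<Phi> (($) a) (l / sqrt \<epsilon>) * F l \<partial>lborel)) / 2)) = (\<integral>\<omega>. cis (a \<bullet> X \<epsilon> \<omega>) \<partial>P)"
          using pos by eventually_elim (simp only: cX)
      qed
    qed
    then show ?thesis by (simp only: X_def Y_def)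
  qed
  have mean: "(\<integral>\<omega>. Re (U_zero I m (A 0) (\<kappa> 0) t x \<omega>) \<partial>P) = 0" if "t > 0" for t x
    by (rule U_zero_mean[OF that \<kappa>0(1) m])
  have fox: "A 0 * c2 (\<kappa> 0) * (\<integral>l. \<bar>l\<bar> powr (\<kappa> 0 - 1) * cos (l * (x - x')) * exp (- (t + t') * l ^ m) \<partial>lborel)
      = 2 * sqrt pi * A 0 * c2 (\<kappa> 0) / (real m * (t + t') powr (\<kappa> 0 / real m))
        * fox_wright_1_1 (\<kappa> 0 / real m) (2 / real m) (1 / 2) 1 (- (x - x')\<^sup>2 / (4 * (t + t') powr (2 / real m)))"
    if "t > 0" "t' > 0" for t t' x x'
    using cos_moment_integral[of "\<kappa> 0" "t + t'" m "x - x'"] that \<kappa>0 m by simp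
  show ?thesis
    using fdd mean fox U_zero_covariance[OF _ _ \<kappa>0(1) m s0] by auto
qed

end
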